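(* Let $d\ge2$ and run the $d$-particle PushTASEP from a fixed initial configuration $\xi^{(1)}_0<\dots<\xi^{(d)}_0$. Let $W_T=(W^1_T,\dots,W^{d-1}_T)$ with $W^i_T=\xi^{(i+1)}_T-\xi^{(i)}_T-1$ be its gap process, $B_d=\{x\in\mathbb Z^{d-1}_{\ge0}: x_i=0\text{ for some }i\}$, and $N^{(d)}_T=\int_0^T\mathbf 1(W_s\in B_d)\,ds$. Then $\mathbb E[N^{(d)}_T]=\Theta(\sqrt T)$ as $T\to\infty$, and for each $1\le i\le d$, $\mathbb E[\xi^{(i)}_T-\xi^{(i)}_0]=T+O(\sqrt T)$.
   Context: PushTASEP: a continuous-time process of $d$ particles at distinct sites of $\mathbb Z$, each particle carrying an independent rate-$1$ exponential clock. When a particle's clock rings it jumps one site to the right; if that site is occupied, the occupying particle is pushed one site to the right, which in turn pushes any particle to its immediate right, and so on. $\xi^{(1)}_T<\dots<\xi^{(d)}_T$ denote the particle positions at time $T$. $\Theta(\sqrt T)$ means bounded above and below by positive constant multiples of $\sqrt T$ for large $T$. *)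

theory Defs
  imports "HOL-Probability.Probability" "HOL-Library.Landau_Symbols"
begin

text \<open>Particles are indexed 0..d-1 (paper: 1..d); a configuration is x :: nat => int,
  only the values at indices < d matter.\<close>

text \<open>Cascade of pushes: particle j-1 has just moved to site x (j-1); if this site
  is occupied by particle j, then particle j is pushed one step right, and so on.\<close>
function cascade :: "nat \<Rightarrow> (nat \<Rightarrow> int) \<Rightarrow> nat \<Rightarrow> (nat \<Rightarrow> int)" where
  "cascade d x j = (if j < d \<and> x j = x (j - 1) then cascade d (x(j := x j + 1)) (Suc j) else x)"
  by auto
termination by (relation "Wellfounded.measure (\<lambda>(d, x, j). d - j)") auto

definition push :: "nat \<Rightarrow> (nat \<Rightarrow> int) \<Rightarrow> nat \<Rightarrow> (nat \<Rightarrow> int)" where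
  "push d x i = cascade d (x(i := x i + 1)) (Suc i)"

text \<open>Clock of particle i: inter-ring times E i 0, E i 1, ...; the k-th ring
  (k = 0,1,...) happens at time E i 0 + ... + E i k.\<close>
definition ring_time :: "(nat \<Rightarrow> nat \<Rightarrow> 'a \<Rightarrow> real) \<Rightarrow> nat \<Rightarrow> nat \<Rightarrow> 'a \<Rightarrow> real" where
  "ring_time E i k \<omega> = (\<Sum>m\<le>k. E i m \<omega>)"

definition ring_count :: "(nat \<Rightarrow> nat \<Rightarrow> 'a \<Rightarrow> real) \<Rightarrow> nat \<Rightarrow> real \<Rightarrow> 'a \<Rightarrow> nat" where
  "ring_count E i t \<omega> = card {k. ring_time E i k \<omega> \<le> t}"

text \<open>Labels of the particles whose clocks rang in [0,t], in chronological order
  (the events (i,k) with ring time \<le> t are listed and then stably sorted by ring time;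
  simultaneous rings and infinitely many rings in [0,t] are null events).\<close>
definition ring_order :: "nat \<Rightarrow> (nat \<Rightarrow> nat \<Rightarrow> 'a \<Rightarrow> real) \<Rightarrow> real \<Rightarrow> 'a \<Rightarrow> nat list" where
  "ring_order d E t \<omega> = map fst (sort_key (\<lambda>(i, k). ring_time E i k \<omega>)
      (concat (map (\<lambda>i. map (\<lambda>k. (i, k)) [0..<ring_count E i t \<omega>]) [0..<d])))"

definition pushtasep :: "nat \<Rightarrow> (nat \<Rightarrow> int) \<Rightarrow> (nat \<Rightarrow> nat \<Rightarrow> 'a \<Rightarrow> real) \<Rightarrow> real \<Rightarrow> 'a \<Rightarrow> (nat \<Rightarrow> int)" where
  "pushtasep d x0 E t \<omega> = foldl (push d) x0 (ring_order d E t \<omega>)"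

definition gap :: "(nat \<Rightarrow> int) \<Rightarrow> nat \<Rightarrow> int" where
  "gap x i = x (Suc i) - x i - 1"

definition in_B :: "nat \<Rightarrow> (nat \<Rightarrow> int) \<Rightarrow> bool" where
  "in_B d x \<longleftrightarrow> (\<forall>i < d - 1. gap x i \<ge> 0) \<and> (\<exists>i < d - 1. gap x i = 0)"

definition occupation :: "nat \<Rightarrow> (nat \<Rightarrow> int) \<Rightarrow> (nat \<Rightarrow> nat \<Rightarrow> 'a \<Rightarrow> real) \<Rightarrow> real \<Rightarrow> 'a \<Rightarrow> real" where
  "occupation d x0 E T \<omega> = (LBINT s=0..T. (if in_B d (pushtasep d x0 E s \<omega>) then 1 else 0))"

end

theory Submission
  imports Defs
begin

text \<open>
  Write W for the gap between particles j and j + 1. A ring of clock j + 1 raises W by one, a ring of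
  clock j lowers it by one unless W = 0, and every other ring can only lower it. Since a clock rings
  at rate one independently of the past, the expected sum of h over the states seen at the rings of
  one clock up to time T equals the expected time integral of h over [0, T]. Applied to powers of W
  this gives E W \<le> W(0) + E(time at W = 0), E W^2 \<le> W(0)^2 + 2 T and E W^3 = O(T^(3/2)); for j = 0 the
  inequalities become equalities, whence E W^2 \<ge> T. So E W = O(sqrt T), and for j = 0 the bounds on the
  second and third moments force E W to be of order sqrt T, which bounds the boundary time from below.
  Particle 0 is a rate-one Poisson process and the other particles are its translates by the gaps, so
  all mean displacements are T + O(sqrt T). Finally particle j + 1 jumps at its own rings and also
  whenever clock j rings with W = 0, so the expected time at W = 0 is at most its mean displacement
  minus T.
\<close>

subsection \<open>One jump\<close>

text \<open>No filtration or martingale is set up. That a clock rings at rate one independently of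
  the past is proved in coordinates: one waiting time is integrated out with all others frozen, and
  Tonelli turns the density at \<open>u\<close> into the probability of still waiting at
  \<open>u\<close>. This works because the left limit at a ring does not change when that ring is
  moved to an earlier time of its own waiting period. The same identity with the constant function 1
  also shows that rings do not accumulate, so this is derived and not assumed; until then the
  waiting periods are only known to lie inside the half-line.

  Everything up to the last conversions is done in \<open>ennreal\<close>, which spares
  integrability questions but forbids subtraction. So gains and losses stand on opposite sides of
  each inequality, and a loss term is cancelled only after a separate, often crude, finiteness
  bound.

  The third moment is needed because a lower bound on the second moment alone does not bound the
  first from below: the mass of the square could sit on rare large values.\<close>

declare cascade.simps [simp del]

lemma all_Suc_less_iff:
  fixes j m :: nat
  assumes "Suc j \<le> m"
  shows "(\<forall>l. j < l \<and> l \<le> m \<longrightarrow> P l) \<longleftrightarrow> P (Suc j) \<and> (\<forall>l. Suc j < l \<and> l \<le> m \<longrightarrow> P l)"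
  using assms by (metis Suc_lessI lessI less_trans)

text \<open>On entry particle \<open>j - 1\<close> has already moved, so a collision at
  \<open>j\<close> reads \<open>x j = x (j - 1)\<close>. The particles further right have not moved
  yet, so for them being reached by the cascade means adjacency,
  \<open>x l = x (l - 1) + 1\<close>.\<close>

lemma cascade_apply:
  "cascade d x j m = x m +
    (if j \<le> m \<and> m < d \<and> x j = x (j - 1) \<and> (\<forall>l. j < l \<and> l \<le> m \<longrightarrow> x l = x (l - 1) + 1) then 1 else 0)"
proof (induction d x j rule: cascade.induct)
  case (1 d x j)
  define Q where "Q = (\<forall>l. j < l \<and> l \<le> m \<longrightarrow> x l = x (l - 1) + 1)"
  show ?case
  proof (cases "j < d \<and> x j = x (j - 1)")
    case True
    define y where "y = x(j := x j + 1)"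
    have IH: "cascade d y (Suc j) m = y m +
      (if Suc j \<le> m \<and> m < d \<and> y (Suc j) = y j \<and> (\<forall>l. Suc j < l \<and> l \<le> m \<longrightarrow> y l = y (l - 1) + 1)
       then 1 else 0)"
      using "1.IH"[OF True, folded y_def] by (simp only: diff_Suc_1)
    have "y l = y (l - 1) + 1 \<longleftrightarrow> x l = x (l - 1) + 1" if "Suc j < l" for l
      using that by (auto simp: y_def)
    \<comment> \<open>After the move \<open>y j\<close> is \<open>x j + 1\<close>, so the collision
      test of the recursive call is the adjacency condition of \<open>x\<close> at
      \<open>Suc j\<close>.\<close>
    moreover have "y (Suc j) = y j \<longleftrightarrow> x (Suc j) = x (Suc j - 1) + 1"
      by (simp add: y_def)
    ultimately have "Suc j \<le> m \<and> m < d \<and> y (Suc j) = y j \<and> (\<forall>l. Suc j < l \<and> l \<le> m \<longrightarrow> y l = y (l - 1) + 1)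
        \<longleftrightarrow> Suc j \<le> m \<and> m < d \<and> Q"
      unfolding Q_def using all_Suc_less_iff[of j m "\<lambda>l. x l = x (l - 1) + 1"] by blast
    moreover have "cascade d x j m = cascade d y (Suc j) m"
      using True by (subst cascade.simps) (simp add: y_def)
    moreover have "Q" if "m = j"
      using that by (simp add: Q_def)
    ultimately show ?thesis
      unfolding IH Q_def[symmetric] using True by (cases m j rule: linorder_cases) (simp_all add: y_def)
  next
    case False
    have "cascade d x j = x"
      by (subst cascade.simps) (simp only: False if_False)
    then show ?thesis
      unfolding Q_def[symmetric] using False by auto
  qed
qed

text \<open>A ring of clock \<open>i\<close> moves the whole packed block that starts at
  \<open>i\<close>. All later facts about a jump are read off from this form, in which the recursion
  has become a condition on gaps.\<close>

lemma push_apply: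
  assumes "i < d"
  shows "push d x i m = x m +
    (if i \<le> m \<and> m < d \<and> (\<forall>l. i \<le> l \<and> l < m \<longrightarrow> gap x l = 0) then 1 else 0)"
proof -
  define y where "y = x(i := x i + 1)"
  define Q where "Q = (\<forall>l. i \<le> l \<and> l < m \<longrightarrow> gap x l = 0)"
  have "y (Suc i) = y (Suc i - 1) \<longleftrightarrow> gap x (Suc i - 1) = 0"
    by (auto simp: y_def gap_def)
  moreover have "y l = y (l - 1) + 1 \<longleftrightarrow> gap x (l - 1) = 0" if "Suc i < l" for l
    using that by (auto simp: y_def gap_def)
  moreover have "Q \<longleftrightarrow> (\<forall>l. i < l \<and> l \<le> m \<longrightarrow> gap x (l - 1) = 0)"
    unfolding Q_def by (metis Suc_le_eq Suc_pred diff_Suc_1 less_Suc_eq_0_disj less_Suc_eq_le not_less_eq)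
  ultimately have "(Suc i \<le> m \<and> m < d \<and> y (Suc i) = y (Suc i - 1) \<and> (\<forall>l. Suc i < l \<and> l \<le> m \<longrightarrow> y l = y (l - 1) + 1))
      \<longleftrightarrow> Suc i \<le> m \<and> m < d \<and> Q"
    using all_Suc_less_iff[of i m "\<lambda>l. gap x (l - 1) = 0"] by blast
  moreover have "Q" if "m = i"
    using that by (simp add: Q_def)
  ultimately show ?thesis
    using assms unfolding push_def y_def[symmetric] cascade_apply Q_def[symmetric]
    by (cases m i rule: linorder_cases) (simp_all add: y_def)
qed

lemma gap_push_right:
  "Suc j < d \<Longrightarrow> gap (push d x (Suc j)) j = gap x j + 1"
  by (simp add: gap_def push_apply)

lemma gap_push_left:
  "Suc j < d \<Longrightarrow> gap (push d x j) j = gap x j - (if gap x j = 0 then 0 else 1)"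
  by (auto simp: gap_def push_apply less_Suc_eq)

lemma gap_push_far_right:
  "Suc j < i \<Longrightarrow> i < d \<Longrightarrow> gap (push d x i) j = gap x j"
  by (simp add: gap_def push_apply)

text \<open>The moved block contains both, neither, or only the left one of the particles
  \<open>j\<close> and \<open>j + 1\<close>. It can stop at \<open>j\<close> only if the gap there
  is nonzero, so the gap shrinks but never becomes negative.\<close>

lemma gap_push_far_left:
  assumes "i < j" "Suc j < d"
  shows "gap (push d x i) j = gap x j \<or> gap x j \<noteq> 0 \<and> gap (push d x i) j = gap x j - 1"
  using assms by (auto simp: gap_def push_apply less_Suc_eq)

lemma push_mono: "i < d \<Longrightarrow> x m \<le> push d x i m"
  by (simp add: push_apply)

text \<open>An invariant of all pushes. Its two clauses guarantee that converting powers of gaps and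
  displacements to \<open>ennreal\<close> truncates nothing.\<close>

definition admissible :: "nat \<Rightarrow> (nat \<Rightarrow> int) \<Rightarrow> (nat \<Rightarrow> int) \<Rightarrow> bool" where
  "admissible d x0 x \<longleftrightarrow> (\<forall>j. Suc j < d \<longrightarrow> 0 \<le> gap x j) \<and> (\<forall>m. x0 m \<le> x m)"

lemma admissible_gap: "admissible d x0 x \<Longrightarrow> Suc j < d \<Longrightarrow> 0 \<le> gap x j"
  by (simp add: admissible_def)

lemma admissible_ge: "admissible d x0 x \<Longrightarrow> x0 m \<le> x m"
  by (simp add: admissible_def)

lemma admissible_push:
  assumes "admissible d x0 x" "i < d"
  shows "admissible d x0 (push d x i)"
proof -
  have "0 \<le> gap (push d x i) j" if "Suc j < d" for j
  proof -
    consider "i = Suc j" | "i = j" | "Suc j < i" | "i < j" by linarith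
    then show ?thesis
      using admissible_gap[OF assms(1) that] that assms(2)
      by cases (use gap_push_far_left[of i j d x] in
        \<open>auto simp: gap_push_right gap_push_left gap_push_far_right\<close>)
  qed
  then show ?thesis
    using assms push_mono[OF assms(2), of x] unfolding admissible_def by (meson order_trans)
qed

lemma admissible_foldl_push:
  assumes "admissible d x0 x" "set ls \<subseteq> {..<d}"
  shows "admissible d x0 (foldl (push d) x ls)"
  using assms by (induction ls arbitrary: x) (auto simp: admissible_push)

subsection \<open>Telescoping along a sequence of jumps\<close>

text \<open>A discrete Dynkin formula: \<open>a\<close> collects gains and \<open>b\<close> losses
  of \<open>\<Phi>\<close>, each evaluated in the state just before the jump. They stay on opposite
  sides because subtraction in \<open>ennreal\<close> truncates.\<close>

lemma foldl_push_le:
  fixes \<Phi> :: "(nat \<Rightarrow> int) \<Rightarrow> ennreal" and a b :: "nat \<Rightarrow> (nat \<Rightarrow> int) \<Rightarrow> ennreal"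
  assumes step: "\<And>x i. admissible d x0 x \<Longrightarrow> i < d \<Longrightarrow> \<Phi> (push d x i) + b i x \<le> \<Phi> x + a i x"
    and x0: "admissible d x0 x0" and ls: "set ls \<subseteq> {..<d}"
  shows "\<Phi> (foldl (push d) x0 ls) + (\<Sum>p<length ls. b (ls ! p) (foldl (push d) x0 (take p ls)))
      \<le> \<Phi> x0 + (\<Sum>p<length ls. a (ls ! p) (foldl (push d) x0 (take p ls)))"
  using ls
proof (induction ls rule: rev_induct)
  case (snoc i ls)
  let ?x = "foldl (push d) x0 ls"
  let ?S = "\<lambda>c. \<Sum>p<length ls. c (ls ! p) (foldl (push d) x0 (take p ls)) :: ennreal"
  have *: "(\<Sum>p<length (ls @ [i]). c ((ls @ [i]) ! p) (foldl (push d) x0 (take p (ls @ [i])))) = ?S c + c i ?x"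
    for c :: "nat \<Rightarrow> (nat \<Rightarrow> int) \<Rightarrow> ennreal"
    by (simp add: nth_append)
  have "\<Phi> (push d ?x i) + b i ?x \<le> \<Phi> ?x + a i ?x"
    using snoc.prems by (intro step admissible_foldl_push x0) auto
  then have "\<Phi> (push d ?x i) + (?S b + b i ?x) \<le> (\<Phi> ?x + ?S b) + a i ?x"
    by (drule_tac add_right_mono[of _ _ "?S b"]) (simp add: ac_simps)
  also have "\<dots> \<le> (\<Phi> x0 + ?S a) + a i ?x"
    using snoc by (intro add_right_mono) auto
  finally show ?case
    unfolding * by (simp add: add.assoc)
qed simp

lemma foldl_push_ge:
  fixes \<Phi> :: "(nat \<Rightarrow> int) \<Rightarrow> ennreal" and a b :: "nat \<Rightarrow> (nat \<Rightarrow> int) \<Rightarrow> ennreal"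
  assumes step: "\<And>x i. admissible d x0 x \<Longrightarrow> i < d \<Longrightarrow> \<Phi> x + a i x \<le> \<Phi> (push d x i) + b i x"
    and x0: "admissible d x0 x0" and ls: "set ls \<subseteq> {..<d}"
  shows "\<Phi> x0 + (\<Sum>p<length ls. a (ls ! p) (foldl (push d) x0 (take p ls)))
      \<le> \<Phi> (foldl (push d) x0 ls) + (\<Sum>p<length ls. b (ls ! p) (foldl (push d) x0 (take p ls)))"
  using ls
proof (induction ls rule: rev_induct)
  case (snoc i ls)
  let ?x = "foldl (push d) x0 ls"
  let ?S = "\<lambda>c. \<Sum>p<length ls. c (ls ! p) (foldl (push d) x0 (take p ls)) :: ennreal"
  have *: "(\<Sum>p<length (ls @ [i]). c ((ls @ [i]) ! p) (foldl (push d) x0 (take p (ls @ [i])))) = ?S c + c i ?x"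
    for c :: "nat \<Rightarrow> (nat \<Rightarrow> int) \<Rightarrow> ennreal"
    by (simp add: nth_append)
  have "(\<Phi> x0 + ?S a) + a i ?x \<le> (\<Phi> ?x + ?S b) + a i ?x"
    using snoc by (intro add_right_mono) auto
  also have "\<Phi> ?x + a i ?x \<le> \<Phi> (push d ?x i) + b i ?x"
    using snoc.prems by (intro step admissible_foldl_push x0) auto
  then have "(\<Phi> ?x + ?S b) + a i ?x \<le> \<Phi> (push d ?x i) + (?S b + b i ?x)"
    by (drule_tac add_right_mono[of _ _ "?S b"]) (simp add: ac_simps)
  finally show ?case
    unfolding * by (simp add: add.assoc)
qed simp

subsection \<open>The process as a function of the clocks\<close>

text \<open>The clocks are regarded as one point \<open>e\<close> of a product space indexed by
  particle and ring number, so that a single waiting time can be replaced by updating one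
  coordinate.\<close>

definition clock_time :: "(nat \<times> nat \<Rightarrow> real) \<Rightarrow> nat \<times> nat \<Rightarrow> real" where
  "clock_time e z = (\<Sum>m\<le>snd z. e (fst z, m))"

definition event_list :: "nat \<Rightarrow> (nat \<Rightarrow> nat) \<Rightarrow> (nat \<times> nat) list" where
  "event_list d n = concat (map (\<lambda>i. map (\<lambda>k. (i, k)) [0..<n i]) [0..<d])"

definition sorted_events :: "nat \<Rightarrow> (nat \<times> nat \<Rightarrow> real) \<Rightarrow> (nat \<Rightarrow> nat) \<Rightarrow> (nat \<times> nat) list" where
  "sorted_events d e n = sort_key (clock_time e) (event_list d n)"

definition events_until :: "nat \<Rightarrow> (nat \<times> nat \<Rightarrow> real) \<Rightarrow> real \<Rightarrow> (nat \<times> nat) list" where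
  "events_until d e t = sorted_events d e (\<lambda>i. card {k. clock_time e (i, k) \<le> t})"

definition events_before :: "nat \<Rightarrow> (nat \<times> nat \<Rightarrow> real) \<Rightarrow> real \<Rightarrow> (nat \<times> nat) list" where
  "events_before d e t = sorted_events d e (\<lambda>i. card {k. clock_time e (i, k) < t})"

definition state_at :: "nat \<Rightarrow> (nat \<Rightarrow> int) \<Rightarrow> (nat \<times> nat \<Rightarrow> real) \<Rightarrow> real \<Rightarrow> nat \<Rightarrow> int" where
  "state_at d x0 e t = foldl (push d) x0 (map fst (events_until d e t))"

text \<open>The left limit of the process at time t: it ignores a ring at time t itself.\<close>

definition state_before :: "nat \<Rightarrow> (nat \<Rightarrow> int) \<Rightarrow> (nat \<times> nat \<Rightarrow> real) \<Rightarrow> real \<Rightarrow> nat \<Rightarrow> int" where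
  "state_before d x0 e t = foldl (push d) x0 (map fst (events_before d e t))"

lemma set_event_list: "set (event_list d n) = {(i, k). i < d \<and> k < n i}"
  by (auto simp: event_list_def)

lemma distinct_event_list: "distinct (event_list d n)"
proof (induction d)
  case (Suc d)
  have "event_list (Suc d) n = event_list d n @ map (\<lambda>k. (d, k)) [0..<n d]"
    by (simp add: event_list_def)
  with Suc show ?case
    by (auto simp: set_event_list distinct_map inj_on_def)
qed (simp add: event_list_def)

lemma event_list_cong: "(\<And>i. i < d \<Longrightarrow> n i = n' i) \<Longrightarrow> event_list d n = event_list d n'"
  unfolding event_list_def by (intro arg_cong[where f=concat] map_cong) auto

lemma insort_key_cong:
  "(\<And>z. z \<in> insert x (set xs) \<Longrightarrow> f z = g z) \<Longrightarrow> insort_key f x xs = insort_key g x xs"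
  by (induction xs) auto

lemma sort_key_cong:
  "(\<And>z. z \<in> set xs \<Longrightarrow> f z = g z) \<Longrightarrow> sort_key f xs = sort_key g xs"
  by (induction xs) (auto intro!: insort_key_cong)

lemma sorted_events_cong:
  assumes "\<And>i. i < d \<Longrightarrow> n i = n' i"
    and "\<And>i k. i < d \<Longrightarrow> k < n i \<Longrightarrow> clock_time e (i, k) = clock_time e' (i, k)"
  shows "sorted_events d e n = sorted_events d e' n'"
proof -
  have "event_list d n' = event_list d n"
    using assms(1) by (intro event_list_cong) simp
  then show ?thesis
    unfolding sorted_events_def using assms(2) by (auto simp: set_event_list intro!: sort_key_cong)
qed

text \<open>The restriction yields a point of the product space over
  \<open>{..<d} \<times> UNIV\<close>, the domain of the measurable functionals below; labels
  outside \<open>{..<d}\<close> never enter \<open>ring_order\<close>.\<close>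

lemma pushtasep_eq_state_at:
  "pushtasep d x0 E t \<omega> = state_at d x0 (restrict (\<lambda>(i, k). E i k \<omega>) ({..<d} \<times> UNIV)) t"
proof -
  let ?c = "restrict (\<lambda>(i, k). E i k \<omega>) ({..<d} \<times> UNIV)"
  have *: "clock_time ?c (i, k) = ring_time E i k \<omega>" if "i < d" for i k
    using that by (simp add: clock_time_def ring_time_def)
  have "ring_order d E t \<omega> = map fst (events_until d ?c t)"
    unfolding ring_order_def events_until_def sorted_events_def event_list_def[symmetric]
    by (subst event_list_cong[of d _ "\<lambda>i. ring_count E i t \<omega>"])
       (auto simp: ring_count_def * set_event_list intro!: arg_cong[where f="map fst"] sort_key_cong)
  then show ?thesis
    by (simp add: pushtasep_def state_at_def)
qed

lemma fst_sorted_events: "set (map fst (sorted_events d e n)) \<subseteq> {..<d}"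
  by (auto simp: sorted_events_def set_event_list)

lemma admissible_state_at:
  "admissible d x0 x0 \<Longrightarrow> admissible d x0 (state_at d x0 e t)"
  unfolding state_at_def events_until_def by (intro admissible_foldl_push fst_sorted_events)

text \<open>The almost sure properties that make the event lists meaningful. On an infinite set
  \<open>card\<close> would return 0, and simultaneous rings would be ordered by label rather than
  by time.\<close>

definition regular_clocks :: "nat \<Rightarrow> (nat \<times> nat \<Rightarrow> real) \<Rightarrow> bool" where
  "regular_clocks d e \<longleftrightarrow> (\<forall>i<d. \<forall>k. 0 < e (i, k)) \<and> inj_on (clock_time e) ({..<d} \<times> UNIV) \<and>
     (\<forall>i<d. \<forall>t. finite {k. clock_time e (i, k) \<le> t})"

lemma clock_time_Suc: "clock_time e (i, Suc k) = clock_time e (i, k) + e (i, Suc k)"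
  by (simp add: clock_time_def)

lemma clock_time_strict_mono:
  assumes "\<And>m. 0 < e (i, m)" "k < l"
  shows "clock_time e (i, k) < clock_time e (i, l)"
  by (rule lift_Suc_mono_less[OF _ \<open>k < l\<close>]) (simp add: clock_time_Suc assms(1))

lemma clock_time_less_iff:
  assumes "\<And>m. 0 < e (i, m)"
  shows "clock_time e (i, k) < clock_time e (i, l) \<longleftrightarrow> k < l"
  using clock_time_strict_mono[of e i k l] clock_time_strict_mono[of e i l k] assms
  by (cases k l rule: linorder_cases) auto

lemma downward_closed_eq_lessThan_card:
  fixes A :: "nat set"
  assumes "finite A" "\<And>k l. l \<in> A \<Longrightarrow> k < l \<Longrightarrow> k \<in> A"
  shows "A = {..<card A}"
proof -
  obtain n where "A = {..<n}"
  proof (cases "A = {}")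
    case False
    have "A = {..<Suc (Max A)}"
      using assms Max_in[OF assms(1) False] Max_ge[OF assms(1)]
      by (auto simp: less_Suc_eq le_less)
    then show thesis by (rule that)
  qed (use that[of 0] in simp)
  then show ?thesis by simp
qed

text \<open>The lists record only how many rings each clock has had. Ring times of one clock
  increase, so these are its first rings and the count determines the set.\<close>

lemma
  assumes "regular_clocks d e"
  shows set_events_until: "set (events_until d e t) = {z \<in> {..<d} \<times> UNIV. clock_time e z \<le> t}"
    and set_events_before: "set (events_before d e t) = {z \<in> {..<d} \<times> UNIV. clock_time e z < t}"
proof -
  have pos: "\<And>m. 0 < e (i, m)" if "i < d" for i
    using assms that by (simp add: regular_clocks_def)
  have fin: "finite {k. clock_time e (i, k) \<le> t}" if "i < d" for i
    using assms that by (simp add: regular_clocks_def)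
  have "{k. clock_time e (i, k) \<le> t} = {..<card {k. clock_time e (i, k) \<le> t}}" if "i < d" for i
    using fin[OF that] clock_time_strict_mono[of e i, OF pos[OF that]]
    by (intro downward_closed_eq_lessThan_card) (auto intro: order.strict_implies_order less_le_trans)
  then show "set (events_until d e t) = {z \<in> {..<d} \<times> UNIV. clock_time e z \<le> t}"
    by (auto simp: events_until_def sorted_events_def set_event_list)
  have "{k. clock_time e (i, k) < t} = {..<card {k. clock_time e (i, k) < t}}" if "i < d" for i
    using finite_subset[OF _ fin[OF that], of "{k. clock_time e (i, k) < t}"]
      clock_time_strict_mono[of e i, OF pos[OF that]]
    by (intro downward_closed_eq_lessThan_card) (auto intro: less_trans simp: Collect_mono_iff)
  then show "set (events_before d e t) = {z \<in> {..<d} \<times> UNIV. clock_time e z < t}"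
    by (auto simp: events_before_def sorted_events_def set_event_list)
qed

lemma distinct_sorted_events: "distinct (sorted_events d e n)"
  by (simp add: sorted_events_def distinct_event_list)

text \<open>Both lists are sorted by an injective key, so it suffices to compare their sets. Hence
  the state that a jump acts on is the left limit at its own ring time, whatever the horizon
  \<open>t\<close>.\<close>

lemma take_events_until:
  assumes e: "regular_clocks d e" and p: "p < length (events_until d e t)"
  shows "take p (events_until d e t) = events_before d e (clock_time e (events_until d e t ! p))"
proof -
  let ?L = "events_until d e t" and ?f = "clock_time e"
  have inj: "inj_on ?f ({..<d} \<times> UNIV)"
    using e by (simp add: regular_clocks_def)
  have setL: "set ?L \<subseteq> {..<d} \<times> UNIV"
    using set_events_until[OF e] by auto
  have dist: "distinct (map ?f ?L)"
    using inj_on_subset[OF inj setL] distinct_sorted_events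
    by (simp add: distinct_map events_until_def)
  have sort: "sorted (map ?f ?L)"
    by (simp add: events_until_def sorted_events_def)
  have less: "?f (?L ! q) < ?f (?L ! r)" if "q < r" "r < length ?L" for q r
    using sorted_nth_mono[OF sort, of q r] that dist
    by (force simp: distinct_conv_nth less_le)
  have setB: "set (events_before d e (?f (?L ! p))) = {z \<in> {..<d} \<times> UNIV. ?f z < ?f (?L ! p)}"
    by (rule set_events_before[OF e])
  have pt: "?f (?L ! p) \<le> t"
    using nth_mem[OF p] unfolding set_events_until[OF e] by simp
  have setT: "set (take p ?L) = {z \<in> {..<d} \<times> UNIV. ?f z < ?f (?L ! p)}"
  proof (intro equalityI subsetI)
    fix z assume "z \<in> set (take p ?L)"
    then obtain q where "q < p" "z = ?L ! q"
      by (auto simp: in_set_conv_nth)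
    then show "z \<in> {z \<in> {..<d} \<times> UNIV. ?f z < ?f (?L ! p)}"
      using less[of q p] p setL nth_mem[of q ?L] by auto
  next
    fix z assume z: "z \<in> {z \<in> {..<d} \<times> UNIV. ?f z < ?f (?L ! p)}"
    with pt have "z \<in> set ?L"
      unfolding set_events_until[OF e] by auto
    then obtain q where q: "q < length ?L" "z = ?L ! q"
      by (auto simp: in_set_conv_nth)
    then have "q < p"
      using z less[of p q] by (cases q p rule: linorder_cases) auto
    then show "z \<in> set (take p ?L)"
      using q by (auto simp: in_set_conv_nth intro!: exI[of _ q])
  qed
  show ?thesis
  proof (rule map_sorted_distinct_set_unique[of ?f])
    show "inj_on ?f (set (take p ?L) \<union> set (events_before d e (?f (?L ! p))))"
      using inj by (rule inj_on_subset) (auto simp: setB setT)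
    show "sorted (map ?f (take p ?L))"
      using sort by (metis sorted_wrt_take take_map)
    show "distinct (map ?f (take p ?L))"
      using dist by (metis distinct_take take_map)
    show "sorted (map ?f (events_before d e (?f (?L ! p))))"
      by (simp add: events_before_def sorted_events_def)
    show "distinct (map ?f (events_before d e (?f (?L ! p))))"
      unfolding distinct_map
    proof
      show "distinct (events_before d e (?f (?L ! p)))"
        by (simp add: events_before_def distinct_sorted_events)
      show "inj_on ?f (set (events_before d e (?f (?L ! p))))"
        using inj by (rule inj_on_subset) (auto simp: setB)
    qed
    show "set (take p ?L) = set (events_before d e (?f (?L ! p)))"
      by (simp add: setB setT)
  qed
qed

text \<open>The integral over [0, T] of \<open>h\<close> of the left limit against the counting
  process of clock \<open>i\<close>.\<close>

definition ring_sum :: "nat \<Rightarrow> (nat \<Rightarrow> int) \<Rightarrow> (nat \<times> nat \<Rightarrow> real) \<Rightarrow> real \<Rightarrow> nat \<Rightarrow>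
    ((nat \<Rightarrow> int) \<Rightarrow> ennreal) \<Rightarrow> ennreal" where
  "ring_sum d x0 e T i h =
    (\<Sum>k. if clock_time e (i, k) \<le> T then h (state_before d x0 e (clock_time e (i, k))) else 0)"

lemma sum_jumps_eq_ring_sum:
  fixes c :: "nat \<Rightarrow> (nat \<Rightarrow> int) \<Rightarrow> ennreal" and T :: real
  assumes e: "regular_clocks d e"
  defines "ls \<equiv> map fst (events_until d e T)"
  shows "(\<Sum>p<length ls. c (ls ! p) (foldl (push d) x0 (take p ls))) = (\<Sum>i<d. ring_sum d x0 e T i (c i))"
proof -
  let ?L = "events_until d e T"
  let ?g = "\<lambda>z. c (fst z) (state_before d x0 e (clock_time e z))"
  have fin: "finite {k. clock_time e (i, k) \<le> T}" if "i < d" for i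
    using e that by (simp add: regular_clocks_def)
  have "(\<Sum>p<length ls. c (ls ! p) (foldl (push d) x0 (take p ls))) = (\<Sum>p<length ?L. ?g (?L ! p))"
    by (intro sum.cong) (simp_all add: ls_def take_map take_events_until[OF e] state_before_def)
  also have "\<dots> = (\<Sum>z\<in>set ?L. ?g z)"
    using distinct_sorted_events
    by (subst sum.distinct_set_conv_list)
       (simp_all add: events_until_def sum_list_sum_nth atLeast0LessThan)
  also have "set ?L = (SIGMA i:{..<d}. {k. clock_time e (i, k) \<le> T})"
    by (auto simp: set_events_until[OF e])
  also have "(\<Sum>z\<in>\<dots>. ?g z) = (\<Sum>i<d. \<Sum>k | clock_time e (i, k) \<le> T. ?g (i, k))"
    using fin by (subst sum.Sigma) (auto simp: case_prod_unfold)
  also have "\<dots> = (\<Sum>i<d. ring_sum d x0 e T i (c i))"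
    unfolding ring_sum_def
  proof (intro sum.cong refl)
    fix i assume "i \<in> {..<d}"
    then show "(\<Sum>k | clock_time e (i, k) \<le> T. ?g (i, k)) =
      (\<Sum>k. if clock_time e (i, k) \<le> T then c i (state_before d x0 e (clock_time e (i, k))) else 0)"
      using fin by (subst suminf_finite[of "{k. clock_time e (i, k) \<le> T}"]) auto
  qed
  finally show ?thesis .
qed

lemma state_at_le:
  assumes step: "\<And>x i. admissible d x0 x \<Longrightarrow> i < d \<Longrightarrow> \<Phi> (push d x i) + b i x \<le> \<Phi> x + (a i x :: ennreal)"
    and x0: "admissible d x0 x0" and e: "regular_clocks d e"
  shows "\<Phi> (state_at d x0 e T) + (\<Sum>i<d. ring_sum d x0 e T i (b i))
    \<le> \<Phi> x0 + (\<Sum>i<d. ring_sum d x0 e T i (a i))"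
  using foldl_push_le[of d x0 \<Phi> b a, OF step x0 fst_sorted_events]
  unfolding sum_jumps_eq_ring_sum[OF e, symmetric] state_at_def events_until_def by blast

lemma state_at_ge:
  assumes step: "\<And>x i. admissible d x0 x \<Longrightarrow> i < d \<Longrightarrow> \<Phi> x + a i x \<le> \<Phi> (push d x i) + (b i x :: ennreal)"
    and x0: "admissible d x0 x0" and e: "regular_clocks d e"
  shows "\<Phi> x0 + (\<Sum>i<d. ring_sum d x0 e T i (a i))
    \<le> \<Phi> (state_at d x0 e T) + (\<Sum>i<d. ring_sum d x0 e T i (b i))"
  using foldl_push_ge[of d x0 \<Phi> a b, OF step x0 fst_sorted_events]
  unfolding sum_jumps_eq_ring_sum[OF e, symmetric] state_at_def events_until_def by blast

subsection \<open>Measurability\<close>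

lemma measurable_count_space_comp2:
  fixes f :: "'a \<Rightarrow> 'b :: countable" and g :: "'a \<Rightarrow> 'c :: countable"
  assumes "f \<in> N \<rightarrow>\<^sub>M count_space UNIV" "g \<in> N \<rightarrow>\<^sub>M count_space UNIV"
  shows "(\<lambda>p. h (f p) (g p)) \<in> N \<rightarrow>\<^sub>M count_space UNIV"
  by (rule measurable_compose_countable[OF measurable_compose_countable[OF _ assms(2)] assms(1)]) simp

lemma measurable_insort_key:
  fixes key :: "'a \<Rightarrow> 'b :: countable \<Rightarrow> real"
  assumes [measurable]: "\<And>z. (\<lambda>p. key p z) \<in> borel_measurable N"
  shows "(\<lambda>p. insort_key (key p) x ys) \<in> N \<rightarrow>\<^sub>M count_space UNIV"
proof (induction ys)
  case (Cons y ys)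
  have [measurable]: "(\<lambda>p. y # insort_key (key p) x ys) \<in> N \<rightarrow>\<^sub>M count_space UNIV"
    by (rule measurable_compose[OF Cons]) simp
  show ?case by simp
qed simp

text \<open>Insertion sort is followed literally: each insertion performs measurable comparisons of
  keys, and the lists range over a countable type.\<close>

lemma measurable_sort_key:
  fixes key :: "'a \<Rightarrow> 'b :: countable \<Rightarrow> real"
  assumes [measurable]: "\<And>z. (\<lambda>p. key p z) \<in> borel_measurable N"
  shows "(\<lambda>p. sort_key (key p) xs) \<in> N \<rightarrow>\<^sub>M count_space UNIV"
proof (induction xs)
  case (Cons x xs)
  then show ?case
    by (simp, intro measurable_compose_countable[OF measurable_insort_key]) auto
qed simp

lemma measurable_event_list:
  assumes "\<And>i. i < d \<Longrightarrow> (\<lambda>p. n p i) \<in> N \<rightarrow>\<^sub>M count_space UNIV"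
  shows "(\<lambda>p. event_list d (n p)) \<in> N \<rightarrow>\<^sub>M count_space UNIV"
  using assms
proof (induction d)
  case (Suc d)
  have "event_list (Suc d) (n p) = event_list d (n p) @ map (\<lambda>k. (d, k)) [0..<n p d]" for p
    by (simp add: event_list_def)
  then show ?case
    using Suc by (simp add: measurable_count_space_comp2[of _ _ _ "\<lambda>xs m. xs @ map (\<lambda>k. (d, k)) [0..<m]"])
qed (simp add: event_list_def)

lemma measurable_clock_time:
  fixes e :: "'b \<Rightarrow> nat \<times> nat \<Rightarrow> real"
  assumes e: "\<And>i k. i < d \<Longrightarrow> (\<lambda>p. e p (i, k)) \<in> borel_measurable N"
  shows "i < d \<Longrightarrow> (\<lambda>p. clock_time (e p) (i, k)) \<in> borel_measurable N"
  unfolding clock_time_def by (auto intro!: borel_measurable_sum e)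

lemma measurable_sorted_events:
  fixes e :: "'b \<Rightarrow> nat \<times> nat \<Rightarrow> real"
  assumes e: "\<And>i k. i < d \<Longrightarrow> (\<lambda>p. e p (i, k)) \<in> borel_measurable N"
    and n: "\<And>i. i < d \<Longrightarrow> (\<lambda>p. n p i) \<in> N \<rightarrow>\<^sub>M count_space UNIV"
  shows "(\<lambda>p. sorted_events d (e p) (n p)) \<in> N \<rightarrow>\<^sub>M count_space UNIV"
proof -
  \<comment> \<open>Ring times are known to be measurable only for labels below \<open>d\<close>;
    the default 0 elsewhere is never consulted, since no such label occurs in
    \<open>event_list\<close>.\<close>
  let ?key = "\<lambda>p z. if fst z < d then clock_time (e p) z else 0"
  have eq: "sorted_events d (e p) (n p) = sort_key (?key p) (event_list d (n p))" for p
    unfolding sorted_events_def by (intro sort_key_cong) (auto simp: set_event_list)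
  have "(\<lambda>p. ?key p z) \<in> borel_measurable N" for z
    using measurable_clock_time[of d e, OF e, of "fst z" "snd z"] by (cases "fst z < d") auto
  then show ?thesis
    unfolding eq
    by (intro measurable_compose_countable[OF measurable_sort_key measurable_event_list] n)
qed

context
  fixes N :: "'b measure" and e :: "'b \<Rightarrow> nat \<times> nat \<Rightarrow> real" and t :: "'b \<Rightarrow> real" and d :: nat
  assumes e: "\<And>i k. i < d \<Longrightarrow> (\<lambda>p. e p (i, k)) \<in> borel_measurable N"
    and t [measurable]: "t \<in> borel_measurable N"
begin

lemma measurable_state_at: "(\<lambda>p. state_at d x0 (e p) (t p)) \<in> N \<rightarrow>\<^sub>M count_space UNIV"
proof -
  have "(\<lambda>p. events_until d (e p) (t p)) \<in> N \<rightarrow>\<^sub>M count_space UNIV"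
    unfolding events_until_def
  proof (intro measurable_sorted_events measurable_card e)
    fix i k assume "i < d"
    note [measurable] = measurable_clock_time[of d e, OF e this]
    show "{p \<in> space N. k \<in> {k. clock_time (e p) (i, k) \<le> t p}} \<in> sets N" by simp
  qed
  from measurable_compose[OF this, of "\<lambda>l. foldl (push d) x0 (map fst l)"]
  show ?thesis by (simp add: state_at_def)
qed

lemma measurable_state_before: "(\<lambda>p. state_before d x0 (e p) (t p)) \<in> N \<rightarrow>\<^sub>M count_space UNIV"
proof -
  have "(\<lambda>p. events_before d (e p) (t p)) \<in> N \<rightarrow>\<^sub>M count_space UNIV"
    unfolding events_before_def
  proof (intro measurable_sorted_events measurable_card e)
    fix i k assume "i < d"
    note [measurable] = measurable_clock_time[of d e, OF e this]
    show "{p \<in> space N. k \<in> {k. clock_time (e p) (i, k) < t p}} \<in> sets N" by simp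
  qed
  from measurable_compose[OF this, of "\<lambda>l. foldl (push d) x0 (map fst l)"]
  show ?thesis by (simp add: state_before_def)
qed

lemma measurable_fun_state_at:
  "(\<lambda>p. h (state_at d x0 (e p) (t p)) :: 'c :: topological_space) \<in> borel_measurable N"
  by (rule measurable_compose[OF measurable_state_at]) simp

lemma measurable_fun_state_before:
  "(\<lambda>p. h (state_before d x0 (e p) (t p)) :: 'c :: topological_space) \<in> borel_measurable N"
  by (rule measurable_compose[OF measurable_state_before]) simp

end

subsection \<open>The compensator of an exponential clock\<close>

lemma nn_integral_exponential_tail:
  assumes "0 \<le> u"
  shows "(\<integral>\<^sup>+x. ennreal (exponential_density 1 x) * indicator {u<..} x \<partial>lborel) = ennreal (exponential_density 1 u)"
proof -
  have "(\<integral>\<^sup>+x. ennreal (exponential_density 1 x) * indicator {u<..} x \<partial>lborel) =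
      (\<integral>\<^sup>+x. ennreal (exp (- x)) * indicator {u..} x \<partial>lborel)"
    using AE_lborel_singleton[of u] assms
    by (intro nn_integral_cong_AE) (auto simp: exponential_density_def split: split_indicator)
  also have "\<dots> = ennreal (0 - (- exp (- u)))"
  proof (rule nn_integral_FTC_atLeast)
    show "((\<lambda>x. - exp (- x)) \<longlongrightarrow> (0::real)) at_top"
      using tendsto_minus[OF filterlim_compose[OF exp_at_bot filterlim_uminus_at_bot_at_top]] by simp
  qed (auto intro!: derivative_eq_intros)
  finally show ?thesis
    using assms by (simp add: exponential_density_def)
qed

text \<open>After exchanging the integrals, the weight of \<open>h u\<close> on the right is the
  tail of the density beyond \<open>u\<close>. For rate one the tail equals the density, that is,
  the hazard rate is 1.\<close>

lemma nn_integral_exponential_eq: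
  fixes h :: "real \<Rightarrow> ennreal"
  assumes [measurable]: "h \<in> borel_measurable borel"
  shows "(\<integral>\<^sup>+x. ennreal (exponential_density 1 x) * h x \<partial>lborel) =
    (\<integral>\<^sup>+x. ennreal (exponential_density 1 x) * (\<integral>\<^sup>+u. indicator {0..<x} u * h u \<partial>lborel) \<partial>lborel)"
proof -
  have [measurable]: "Measurable.pred (lborel \<Otimes>\<^sub>M lborel) (\<lambda>z::real \<times> real. fst z \<in> {0..<snd z})"
    by simp
  have "(\<integral>\<^sup>+x. ennreal (exponential_density 1 x) * (\<integral>\<^sup>+u. indicator {0..<x} u * h u \<partial>lborel) \<partial>lborel) =
      (\<integral>\<^sup>+x. \<integral>\<^sup>+u. ennreal (exponential_density 1 x) * (indicator {0..<x} u * h u) \<partial>lborel \<partial>lborel)"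
    by (intro nn_integral_cong nn_integral_cmult[symmetric]) auto
  also have "\<dots> = (\<integral>\<^sup>+u. \<integral>\<^sup>+x. ennreal (exponential_density 1 x) * (indicator {0..<x} u * h u) \<partial>lborel \<partial>lborel)"
    by (intro lborel_pair.Fubini') (unfold case_prod_unfold, measurable)
  also have "\<dots> = (\<integral>\<^sup>+u. ennreal (exponential_density 1 u) * h u \<partial>lborel)"
  proof (intro nn_integral_cong)
    fix u :: real
    have "(\<integral>\<^sup>+x. ennreal (exponential_density 1 x) * (indicator {0..<x} u * h u) \<partial>lborel) =
        (\<integral>\<^sup>+x. (indicator {0..} u * h u) * (ennreal (exponential_density 1 x) * indicator {u<..} x) \<partial>lborel)"
      by (intro nn_integral_cong) (auto split: split_indicator simp: mult.commute)
    also have "\<dots> = (indicator {0..} u * h u) * (\<integral>\<^sup>+x. ennreal (exponential_density 1 x) * indicator {u<..} x \<partial>lborel)"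
      by (intro nn_integral_cmult) simp
    also have "\<dots> = ennreal (exponential_density 1 u) * h u"
    proof (cases "0 \<le> u")
      case True
      then show ?thesis
        unfolding nn_integral_exponential_tail[OF True] by (simp add: mult.commute)
    qed (simp add: exponential_density_def)
    finally show "(\<integral>\<^sup>+x. ennreal (exponential_density 1 x) * (indicator {0..<x} u * h u) \<partial>lborel) =
      ennreal (exponential_density 1 u) * h u" .
  qed
  finally show ?thesis ..
qed

text \<open>The product law \<open>J\<close> allows \<open>Y\<close> to be frozen while the
  one-dimensional identity is applied to \<open>X\<close>.\<close>

lemma (in prob_space) nn_integral_exponential_product:
  fixes f :: "real \<times> 'b \<Rightarrow> ennreal"
  assumes X: "distributed M lborel X (exponential_density 1)"
    and Y [measurable]: "Y \<in> M \<rightarrow>\<^sub>M N"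
    and J: "distr M (borel \<Otimes>\<^sub>M N) (\<lambda>\<omega>. (X \<omega>, Y \<omega>)) = distr M borel X \<Otimes>\<^sub>M distr M N Y"
    and f [measurable]: "f \<in> borel_measurable (borel \<Otimes>\<^sub>M N)"
  shows "(\<integral>\<^sup>+\<omega>. f (X \<omega>, Y \<omega>) \<partial>M) = (\<integral>\<^sup>+\<omega>. \<integral>\<^sup>+u. indicator {0..<X \<omega>} u * f (u, Y \<omega>) \<partial>lborel \<partial>M)"
proof -
  have [measurable]: "X \<in> borel_measurable M"
    using distributed_measurable[OF X] by simp
  let ?D = "density lborel (exponential_density 1)" and ?Y = "distr M N Y"
  have DX: "distr M borel X = ?D"
    using distributed_distr_eq_density[OF X] by (simp cong: distr_cong)
  interpret Y: prob_space ?Y by (rule prob_space_distr) simp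
  interpret D: prob_space ?D by (rule prob_space_exponential_density) simp
  interpret P: pair_sigma_finite ?D ?Y ..
  have *: "(\<integral>\<^sup>+\<omega>. g (X \<omega>, Y \<omega>) \<partial>M) = (\<integral>\<^sup>+y. \<integral>\<^sup>+x. ennreal (exponential_density 1 x) * g (x, y) \<partial>lborel \<partial>?Y)"
    if [measurable]: "g \<in> borel_measurable (borel \<Otimes>\<^sub>M N)" for g :: "real \<times> 'b \<Rightarrow> ennreal"
  proof -
    have "(\<integral>\<^sup>+\<omega>. g (X \<omega>, Y \<omega>) \<partial>M) = (\<integral>\<^sup>+z. g z \<partial>distr M (borel \<Otimes>\<^sub>M N) (\<lambda>\<omega>. (X \<omega>, Y \<omega>)))"
      by (subst nn_integral_distr) auto
    also have "\<dots> = (\<integral>\<^sup>+y. \<integral>\<^sup>+x. g (x, y) \<partial>?D \<partial>?Y)"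
      unfolding J DX by (rule P.nn_integral_snd[symmetric]) simp
    also have "\<dots> = (\<integral>\<^sup>+y. \<integral>\<^sup>+x. ennreal (exponential_density 1 x) * g (x, y) \<partial>lborel \<partial>?Y)"
      by (intro nn_integral_cong nn_integral_density) auto
    finally show ?thesis .
  qed
  have [measurable]: "Measurable.pred ((borel \<Otimes>\<^sub>M N) \<Otimes>\<^sub>M borel) (\<lambda>z. snd z \<in> {0..<fst (fst z)::real})"
    by simp
  have "(\<integral>\<^sup>+\<omega>. f (X \<omega>, Y \<omega>) \<partial>M) = (\<integral>\<^sup>+y. \<integral>\<^sup>+x. ennreal (exponential_density 1 x) * f (x, y) \<partial>lborel \<partial>?Y)"
    by (rule *) simp
  also have "\<dots> = (\<integral>\<^sup>+y. \<integral>\<^sup>+x. ennreal (exponential_density 1 x) *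
      (\<integral>\<^sup>+u. indicator {0..<x} u * f (u, y) \<partial>lborel) \<partial>lborel \<partial>?Y)"
    by (intro nn_integral_cong nn_integral_exponential_eq) auto
  also have "\<dots> = (\<integral>\<^sup>+\<omega>. \<integral>\<^sup>+u. indicator {0..<X \<omega>} u * f (u, Y \<omega>) \<partial>lborel \<partial>M)"
    using *[of "\<lambda>z. \<integral>\<^sup>+u. indicator {0..<fst z} u * f (u, snd z) \<partial>lborel"] by simp
  finally show ?thesis .
qed

subsection \<open>Independent exponential clocks\<close>

lemma clock_time_eq_sum: "clock_time e (i, k) = (\<Sum>m<k. e (i, m)) + e (i, k)"
  by (simp add: clock_time_def lessThan_Suc_atMost[symmetric])

lemma clock_time_eq_sum_lessThan: "clock_time e (i, k) = (\<Sum>m<Suc k. e (i, m))"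
  by (simp add: clock_time_def lessThan_Suc_atMost)

text \<open>Moving the current ring of clock i to the earlier time s does not change the past of s.\<close>

lemma state_before_upd:
  assumes "i < d" and pos: "\<And>m. 0 < e (i, m)" and u: "0 \<le> u" "u < e (i, k)"
  defines "s \<equiv> (\<Sum>m<k. e (i, m)) + u"
  shows "state_before d x0 (e((i, k) := u)) s = state_before d x0 e s"
proof -
  let ?e = "e((i, k) := u)"
  have other: "clock_time ?e (j, m) = clock_time e (j, m)" if "j \<noteq> i \<or> m < k" for j m
    unfolding clock_time_def using that by (intro sum.cong) auto
  \<comment> \<open>Under both clocks, ring \<open>k\<close> and its successors come no earlier than
    \<open>s\<close>. The moved ring occurs exactly at \<open>s\<close>, and the strict inequality
    in \<open>events_before\<close> excludes it.\<close>
  have late: "s \<le> clock_time ?e (i, m)" "s \<le> clock_time e (i, m)" if "k \<le> m" for m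
  proof -
    have "clock_time ?e (i, k) \<le> clock_time ?e (i, m)"
      unfolding clock_time_def fst_conv snd_conv using that u pos by (intro sum_mono2) (auto intro: less_imp_le)
    moreover have "clock_time ?e (i, k) = s"
      unfolding s_def clock_time_eq_sum by simp
    ultimately show "s \<le> clock_time ?e (i, m)" by simp
    have "clock_time e (i, k) \<le> clock_time e (i, m)"
      unfolding clock_time_def fst_conv snd_conv using that pos by (intro sum_mono2) (auto intro: less_imp_le)
    moreover have "s \<le> clock_time e (i, k)"
      unfolding s_def clock_time_eq_sum using u by simp
    ultimately show "s \<le> clock_time e (i, m)" by simp
  qed
  have iff: "clock_time ?e (j, m) < s \<longleftrightarrow> clock_time e (j, m) < s" for j m
    using other[of j m] late[of m] by (cases "j \<noteq> i \<or> m < k") auto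
  \<comment> \<open>So the list of events before \<open>s\<close> consults clock \<open>i\<close>
    only at rings with number below \<open>k\<close>, whose times the update leaves alone.\<close>
  have "card {m. clock_time ?e (i, m) < s} \<le> card {..<k}"
    by (intro card_mono) (auto simp: not_le[symmetric] dest: late)
  then have "events_before d ?e s = events_before d e s"
    unfolding events_before_def
    by (intro sorted_events_cong) (auto simp: iff intro!: other)
  then show ?thesis
    by (simp add: state_before_def)
qed

lemma disjoint_ring_intervals:
  fixes e :: "nat \<times> nat \<Rightarrow> real"
  assumes "\<And>m. 0 < e (i, m)"
  shows "disjoint_family (\<lambda>k. {(\<Sum>m<k. e (i, m))..<(\<Sum>m<Suc k. e (i, m))})"
proof -
  have "{(\<Sum>m<k. e (i, m))..<(\<Sum>m<Suc k. e (i, m))} \<inter> {(\<Sum>m<l. e (i, m))..<(\<Sum>m<Suc l. e (i, m))} = {}"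
    if "k < l" for k l
  proof -
    have "(\<Sum>m<Suc k. e (i, m)) \<le> (\<Sum>m<l. e (i, m))"
      using that assms by (intro sum_mono2) (auto intro: less_imp_le)
    then show ?thesis by auto
  qed
  then show ?thesis
    unfolding disjoint_family_on_def by (metis Int_commute linorder_neqE_nat)
qed

text \<open>The k-th interval is the waiting period of ring \<open>k\<close>. The inclusion holds
  even if the rings accumulate, and it is what the proof that they do not relies on.\<close>

lemma Union_ring_intervals_subset:
  fixes e :: "nat \<times> nat \<Rightarrow> real"
  assumes "\<And>m. 0 < e (i, m)"
  shows "(\<Union>k. {(\<Sum>m<k. e (i, m))..<(\<Sum>m<Suc k. e (i, m))}) \<subseteq> {0..}"
proof -
  have "0 \<le> (\<Sum>m<k. e (i, m))" for k
    using assms by (intro sum_nonneg) (auto intro: less_imp_le)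
  then show ?thesis by (force intro: order_trans)
qed

lemma Union_ring_intervals_eq:
  fixes e :: "nat \<times> nat \<Rightarrow> real"
  assumes "\<And>m. 0 < e (i, m)" and fin: "\<And>t. finite {k. clock_time e (i, k) \<le> t}"
  shows "(\<Union>k. {(\<Sum>m<k. e (i, m))..<(\<Sum>m<Suc k. e (i, m))}) = {0..}"
proof (intro equalityI Union_ring_intervals_subset[where e=e and i=i, OF assms(1)] subsetI)
  fix s :: real assume "s \<in> {0..}"
  define k where "k = (LEAST k. s < clock_time e (i, k))"
  have "\<exists>k. k \<notin> {k. clock_time e (i, k) \<le> s}"
    using fin[of s] by (metis ex_new_if_finite infinite_UNIV_nat)
  then have k: "s < clock_time e (i, k)"
    unfolding k_def by (auto intro!: LeastI_ex simp: not_le)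
  have "(\<Sum>m<k. e (i, m)) \<le> s"
  proof (cases k)
    case (Suc l)
    then have "\<not> s < clock_time e (i, l)"
      unfolding k_def by (intro not_less_Least) auto
    then show ?thesis by (simp add: Suc clock_time_eq_sum_lessThan)
  qed (use \<open>s \<in> {0..}\<close> in simp)
  with k show "s \<in> (\<Union>k. {(\<Sum>m<k. e (i, m))..<(\<Sum>m<Suc k. e (i, m))})"
    by (auto simp: clock_time_eq_sum_lessThan intro!: exI[of _ k])
qed

locale exponential_clocks = prob_space M for M :: "'a measure" +
  fixes d :: nat and E :: "nat \<Rightarrow> nat \<Rightarrow> 'a \<Rightarrow> real"
  assumes indep: "indep_vars (\<lambda>_. borel) (\<lambda>(i, k). E i k) ({..<d} \<times> UNIV)"
    and exponential: "\<And>i k. i < d \<Longrightarrow> distributed M lborel (E i k) (exponential_density 1)"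
begin

definition clocks :: "'a \<Rightarrow> nat \<times> nat \<Rightarrow> real" where
  "clocks \<omega> = restrict (\<lambda>(i, k). E i k \<omega>) ({..<d} \<times> UNIV)"

lemma clocks_apply: "i < d \<Longrightarrow> clocks \<omega> (i, k) = E i k \<omega>"
  by (simp add: clocks_def)

lemma measurable_E: "i < d \<Longrightarrow> E i k \<in> borel_measurable M"
  using distributed_measurable[OF exponential] by simp

lemma measurable_clocks_apply: "i < d \<Longrightarrow> (\<lambda>\<omega>. clocks \<omega> (i, k)) \<in> borel_measurable M"
  by (simp add: clocks_apply measurable_E)

lemma measurable_clock_time_clocks:
  "i < d \<Longrightarrow> (\<lambda>\<omega>. clock_time (clocks \<omega>) (i, k)) \<in> borel_measurable M"
  by (rule measurable_clock_time[of d clocks, OF measurable_clocks_apply])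

text \<open>The time integral of G along the waiting time of ring (i,k) compensates the value of G at that ring:
  the density of an exponential variable at u is its probability of exceeding u.\<close>

lemma nn_integral_resample:
  assumes i: "i < d" and G [measurable]: "G \<in> borel_measurable (PiM ({..<d} \<times> UNIV) (\<lambda>_. borel))"
  shows "(\<integral>\<^sup>+\<omega>. G (clocks \<omega>) \<partial>M) =
    (\<integral>\<^sup>+\<omega>. \<integral>\<^sup>+u. indicator {0..<E i k \<omega>} u * G ((clocks \<omega>)((i, k) := u)) \<partial>lborel \<partial>M)"
proof -
  let ?I = "{..<d} \<times> UNIV :: (nat \<times> nat) set"
  let ?c = "\<lambda>\<omega>. \<lambda>(i, k). E i k \<omega>"
  \<comment> \<open>All coordinates except the one that is integrated out.\<close>
  define B where "B = ?I - {(i, k)}"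
  let ?P = "\<lambda>A. PiM A (\<lambda>_. borel) :: (nat \<times> nat \<Rightarrow> real) measure"
  define X where "X \<omega> = restrict (?c \<omega>) {(i, k)}" for \<omega>
  define Y where "Y \<omega> = restrict (?c \<omega>) B" for \<omega>
  have case_prod_eq: "(case z of (i, k) \<Rightarrow> E i k) \<omega> = (case z of (i, k) \<Rightarrow> E i k \<omega>)" for z \<omega>
    by (cases z) simp
  have ind: "indep_var (?P {(i, k)}) X (?P B) Y"
    using indep_var_restrict[OF indep, of "{(i, k)}" B] i
    unfolding X_def Y_def B_def case_prod_eq by auto
  have X [measurable]: "X \<in> M \<rightarrow>\<^sub>M ?P {(i, k)}" and Y [measurable]: "Y \<in> M \<rightarrow>\<^sub>M ?P B"
    using indep_var_rv1[OF ind] indep_var_rv2[OF ind] by auto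
  have [measurable]: "E i k \<in> borel_measurable M"
    by (rule measurable_E[OF i])
  have ev [measurable]: "(\<lambda>a. a (i, k)) \<in> ?P {(i, k)} \<rightarrow>\<^sub>M borel"
    by (rule measurable_component_singleton) simp
  have EX: "E i k = (\<lambda>\<omega>. X \<omega> (i, k))"
    by (simp add: X_def fun_eq_iff)
  interpret PX: prob_space "distr M (?P {(i, k)}) X" by (rule prob_space_distr) simp
  interpret PY: prob_space "distr M (?P B) Y" by (rule prob_space_distr) simp
  \<comment> \<open>\<open>ind\<close> gives a product law for \<open>X\<close>, whose values are
    functions on a one-point index set. Evaluation at that point transfers it to the real variable
    \<open>E i k\<close>.\<close>
  have "distr M borel (E i k) \<Otimes>\<^sub>M distr M (?P B) Y =
      distr (distr M (?P {(i, k)}) X) borel (\<lambda>a. a (i, k)) \<Otimes>\<^sub>M distr (distr M (?P B) Y) (?P B) (\<lambda>y. y)"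
    by (simp add: distr_distr comp_def EX distr_id2)
  also have "\<dots> = distr (distr M (?P {(i, k)}) X \<Otimes>\<^sub>M distr M (?P B) Y) (borel \<Otimes>\<^sub>M ?P B) (\<lambda>(a, y). (a (i, k), y))"
    by (intro pair_measure_distr) (auto intro!: prob_space_imp_sigma_finite prob_space_distr
        PX.prob_space_distr PY.prob_space_distr)
  also have "\<dots> = distr M (borel \<Otimes>\<^sub>M ?P B) (\<lambda>\<omega>. (E i k \<omega>, Y \<omega>))"
    using ind unfolding indep_var_distribution_eq
    by (simp add: distr_distr comp_def EX)
  finally have J: "distr M (borel \<Otimes>\<^sub>M ?P B) (\<lambda>\<omega>. (E i k \<omega>, Y \<omega>)) = distr M borel (E i k) \<Otimes>\<^sub>M distr M (?P B) Y" ..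
  have insB: "insert (i, k) B = ?I"
    using i by (auto simp: B_def)
  have [measurable]: "(\<lambda>p. (snd p)((i, k) := fst p)) \<in> borel \<Otimes>\<^sub>M ?P B \<rightarrow>\<^sub>M ?P ?I"
    using measurable_compose[of "\<lambda>p. (snd p, fst p)" "borel \<Otimes>\<^sub>M ?P B" "?P B \<Otimes>\<^sub>M borel",
        OF _ measurable_add_dim[of "(i, k)" B "\<lambda>_. borel"]]
    by (simp add: insB)
  have upd: "(clocks \<omega>)((i, k) := u) = (Y \<omega>)((i, k) := u)" for \<omega> u
    by (auto simp: clocks_def Y_def B_def fun_eq_iff)
  have "(Y \<omega>)((i, k) := E i k \<omega>) = clocks \<omega>" for \<omega>
    unfolding upd[symmetric] using i by (simp add: clocks_apply fun_eq_iff)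
  then have "(\<integral>\<^sup>+\<omega>. G (clocks \<omega>) \<partial>M) = (\<integral>\<^sup>+\<omega>. G ((Y \<omega>)((i, k) := E i k \<omega>)) \<partial>M)"
    by simp
  also have "\<dots> = (\<integral>\<^sup>+\<omega>. \<integral>\<^sup>+u. indicator {0..<E i k \<omega>} u * G ((Y \<omega>)((i, k) := u)) \<partial>lborel \<partial>M)"
    using nn_integral_exponential_product[OF exponential[OF i] Y J, of "\<lambda>p. G ((snd p)((i, k) := fst p))"]
    by simp
  finally show ?thesis
    unfolding upd .
qed

lemma AE_positive: "AE \<omega> in M. \<forall>i<d. \<forall>k. 0 < clocks \<omega> (i, k)"
proof -
  have "AE \<omega> in M. i < d \<longrightarrow> 0 < E i k \<omega>" for i k
  proof (cases "i < d")
    case True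
    note [measurable] = measurable_E[OF True]
    have "\<P>(\<omega> in M. E i k \<omega> \<le> 0) = 0"
      using exponential_distributedD_le[OF exponential[OF True], of 0 k] by simp
    then have "AE \<omega> in M. \<not> E i k \<omega> \<le> 0"
      by (subst (asm) prob_eq_0) auto
    then show ?thesis by eventually_elim auto
  qed simp
  then have "AE \<omega> in M. \<forall>i k. i < d \<longrightarrow> 0 < E i k \<omega>"
    by (simp add: AE_all_countable)
  then show ?thesis
    by eventually_elim (simp add: clocks_apply)
qed

lemma measurable_PiM_apply:
  "i < d \<Longrightarrow> (\<lambda>e. e (i, k)) \<in> borel_measurable (PiM ({..<d} \<times> UNIV) (\<lambda>_. borel :: real measure))"
  by (rule measurable_component_singleton) simp

text \<open>With all other waiting times frozen, a coincidence of the two rings is possible for only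
  one value of the waiting time \<open>(i, k)\<close>, and a single point has Lebesgue measure
  zero.\<close>

lemma AE_clock_time_neq:
  assumes "i < d" "j < d" "i \<noteq> j"
  shows "AE \<omega> in M. clock_time (clocks \<omega>) (i, k) \<noteq> clock_time (clocks \<omega>) (j, l)"
proof -
  let ?P = "PiM ({..<d} \<times> UNIV) (\<lambda>_. borel :: real measure)"
  note [measurable] = measurable_clock_time[of d "\<lambda>e. e" ?P, OF measurable_PiM_apply assms(1), of k]
    measurable_clock_time[of d "\<lambda>e. e" ?P, OF measurable_PiM_apply assms(2), of l]
  define G :: "(nat \<times> nat \<Rightarrow> real) \<Rightarrow> ennreal"
    where "G e = (if clock_time e (i, k) = clock_time e (j, l) then 1 else 0)" for e
  have G: "G \<in> borel_measurable ?P"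
    unfolding G_def using assms by measurable
  have "(\<integral>\<^sup>+u. indicator {0..<E i k \<omega>} u * G ((clocks \<omega>)((i, k) := u)) \<partial>lborel) = 0" for \<omega>
  proof -
    \<comment> \<open>The only waiting time at which the two rings would coincide.\<close>
    define v where "v = clock_time (clocks \<omega>) (j, l) - (\<Sum>m<k. clocks \<omega> (i, m))"
    have "clock_time ((clocks \<omega>)((i, k) := u)) (j, l) = clock_time (clocks \<omega>) (j, l)" for u
      using assms by (simp add: clock_time_def)
    moreover have "clock_time ((clocks \<omega>)((i, k) := u)) (i, k) = (\<Sum>m<k. clocks \<omega> (i, m)) + u" for u
      by (simp add: clock_time_eq_sum)
    ultimately have "G ((clocks \<omega>)((i, k) := u)) = 0" if "u \<noteq> v" for u
      using that by (auto simp: G_def v_def)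
    then have "AE u in lborel. indicator {0..<E i k \<omega>} u * G ((clocks \<omega>)((i, k) := u)) = 0"
      using AE_lborel_singleton[of v] by (auto elim!: eventually_mono)
    then have "(\<integral>\<^sup>+u. indicator {0..<E i k \<omega>} u * G ((clocks \<omega>)((i, k) := u)) \<partial>lborel) = (\<integral>\<^sup>+u. 0 \<partial>(lborel :: real measure))"
      by (rule nn_integral_cong_AE)
    then show ?thesis by simp
  qed
  then have "(\<integral>\<^sup>+\<omega>. G (clocks \<omega>) \<partial>M) = 0"
    unfolding nn_integral_resample[OF assms(1) G, of k] by simp
  moreover have [measurable]: "(\<lambda>\<omega>. clock_time (clocks \<omega>) (i, k)) \<in> borel_measurable M"
    "(\<lambda>\<omega>. clock_time (clocks \<omega>) (j, l)) \<in> borel_measurable M"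
    using assms by (auto intro: measurable_clock_time_clocks)
  moreover have "(\<lambda>\<omega>. G (clocks \<omega>)) \<in> borel_measurable M"
    unfolding G_def by measurable
  ultimately have "AE \<omega> in M. G (clocks \<omega>) = 0"
    by (simp add: nn_integral_0_iff_AE)
  then show ?thesis
    by eventually_elim (auto simp: G_def split: if_splits)
qed

lemma AE_inj: "AE \<omega> in M. inj_on (clock_time (clocks \<omega>)) ({..<d} \<times> UNIV)"
proof -
  have "AE \<omega> in M. i < d \<and> j < d \<and> i \<noteq> j \<longrightarrow> clock_time (clocks \<omega>) (i, k) \<noteq> clock_time (clocks \<omega>) (j, l)"
    for i j k l
    by (cases "i < d \<and> j < d \<and> i \<noteq> j") (use AE_clock_time_neq[of i j k l] in auto)
  then have "AE \<omega> in M. \<forall>i j k l. i < d \<and> j < d \<and> i \<noteq> j \<longrightarrow>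
      clock_time (clocks \<omega>) (i, k) \<noteq> clock_time (clocks \<omega>) (j, l)"
    by (simp add: AE_all_countable)
  with AE_positive show ?thesis
  proof eventually_elim
    case (elim \<omega>)
    show ?case
    proof (intro inj_onI)
      fix y z assume yz: "y \<in> {..<d} \<times> (UNIV :: nat set)" "z \<in> {..<d} \<times> (UNIV :: nat set)"
        "clock_time (clocks \<omega>) y = clock_time (clocks \<omega>) z"
      then have "fst y = fst z"
        using elim(2) by (cases y; cases z) auto
      moreover have "snd y = snd z"
        using clock_time_less_iff[of "clocks \<omega>" "fst y" "snd y" "snd z"]
          clock_time_less_iff[of "clocks \<omega>" "fst y" "snd z" "snd y"] yz elim(1) \<open>fst y = fst z\<close>
        by (cases y; cases z) (auto simp: not_less_iff_gr_or_eq)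
      ultimately show "y = z" by (simp add: prod_eq_iff)
    qed
  qed
qed

end

section \<open>Expected ring sums as time integrals\<close>

lemma state_at_eq_state_before:
  assumes "s \<notin> clock_time e ` ({..<d} \<times> UNIV)"
  shows "state_at d x0 e s = state_before d x0 e s"
proof -
  have "clock_time e (i, k) \<le> s \<longleftrightarrow> clock_time e (i, k) < s" if "i < d" for i k
    using assms that by (auto simp: less_le)
  then have "events_until d e s = events_before d e s"
    unfolding events_until_def events_before_def by (intro sorted_events_cong) auto
  then show ?thesis
    by (simp add: state_at_def state_before_def)
qed

lemma AE_state_at_eq_state_before: "AE s in lborel. state_at d x0 e s = state_before d x0 e s"
proof -
  have "clock_time e ` ({..<d} \<times> UNIV) \<in> null_sets lborel"
    by (intro countable_imp_null_set_lborel countable_image countable_SIGMA) auto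
  from AE_not_in[OF this] show ?thesis
    by eventually_elim (rule state_at_eq_state_before)
qed

context exponential_clocks
begin

lemma measurable_state_before_pair [measurable]:
  "(\<lambda>p. h (state_before d x0 (clocks (fst p)) (snd p)) :: ennreal) \<in> borel_measurable (M \<Otimes>\<^sub>M lborel)"
  by (rule measurable_fun_state_before) (auto intro: measurable_compose[OF measurable_fst measurable_clocks_apply])

lemma measurable_state_at_pair:
  "(\<lambda>p. h (state_at d x0 (clocks (fst p)) (snd p)) :: ennreal) \<in> borel_measurable (M \<Otimes>\<^sub>M lborel)"
  by (rule measurable_fun_state_at) (auto intro: measurable_compose[OF measurable_fst measurable_clocks_apply])

lemma measurable_fun_state_at_clocks:
  "(\<lambda>\<omega>. h (state_at d x0 (clocks \<omega>) t) :: 'c :: topological_space) \<in> borel_measurable M"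
  by (rule measurable_fun_state_at) (auto intro: measurable_clocks_apply)

lemma measurable_sum_clocks: "i < d \<Longrightarrow> (\<lambda>\<omega>. \<Sum>m<k. clocks \<omega> (i, m)) \<in> borel_measurable M"
  by (auto intro!: borel_measurable_sum measurable_clocks_apply)

text \<open>Resampling moves ring \<open>k\<close> to a time \<open>s\<close> within its waiting
  period. By \<open>state_before_upd\<close> the moved ring sees the left limit of the original
  process at \<open>s\<close>, so integrating over the resampled waiting time is integrating along
  the path.\<close>

lemma nn_integral_ring:
  assumes i: "i < d"
  shows "(\<integral>\<^sup>+\<omega>. (if clock_time (clocks \<omega>) (i, k) \<le> T
        then h (state_before d x0 (clocks \<omega>) (clock_time (clocks \<omega>) (i, k))) else 0) \<partial>M) =
    (\<integral>\<^sup>+\<omega>. \<integral>\<^sup>+s. indicator {(\<Sum>m<k. clocks \<omega> (i, m))..<(\<Sum>m<Suc k. clocks \<omega> (i, m))} s *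
        (if s \<le> T then h (state_before d x0 (clocks \<omega>) s) else 0) \<partial>lborel \<partial>M)"
proof -
  let ?P = "PiM ({..<d} \<times> UNIV) (\<lambda>_. borel :: real measure)"
  define G :: "(nat \<times> nat \<Rightarrow> real) \<Rightarrow> ennreal" where
    "G e = (if clock_time e (i, k) \<le> T then h (state_before d x0 e (clock_time e (i, k))) else 0)" for e
  have [measurable]: "(\<lambda>e. clock_time e (i, k)) \<in> borel_measurable ?P"
    by (rule measurable_clock_time[of d "\<lambda>e. e", OF measurable_PiM_apply i])
  have [measurable]: "(\<lambda>e. h (state_before d x0 e (clock_time e (i, k)))) \<in> borel_measurable ?P"
    by (rule measurable_fun_state_before[of d "\<lambda>e. e"]) (simp_all add: measurable_PiM_apply)
  have G: "G \<in> borel_measurable ?P"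
    unfolding G_def by measurable
  have "(\<integral>\<^sup>+\<omega>. G (clocks \<omega>) \<partial>M) =
    (\<integral>\<^sup>+\<omega>. \<integral>\<^sup>+u. indicator {0..<E i k \<omega>} u * G ((clocks \<omega>)((i, k) := u)) \<partial>lborel \<partial>M)"
    by (rule nn_integral_resample[OF i G])
  also have "\<dots> = (\<integral>\<^sup>+\<omega>. \<integral>\<^sup>+s. indicator {(\<Sum>m<k. clocks \<omega> (i, m))..<(\<Sum>m<Suc k. clocks \<omega> (i, m))} s *
        (if s \<le> T then h (state_before d x0 (clocks \<omega>) s) else 0) \<partial>lborel \<partial>M)"
  proof (rule nn_integral_cong_AE, use AE_positive in eventually_elim)
    case (elim \<omega>)
    let ?c = "clocks \<omega>" and ?p = "\<Sum>m<k. clocks \<omega> (i, m)"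
    define F where "F s = (if s \<le> T then h (state_before d x0 ?c s) else 0)" for s
    have [measurable]: "(\<lambda>s. h (state_before d x0 ?c s)) \<in> borel_measurable borel"
      by (rule measurable_fun_state_before) simp_all
    have [measurable]: "F \<in> borel_measurable borel"
      unfolding F_def by measurable
    \<comment> \<open>The form \<open>?p + 1 * u\<close> matches the affine substitution with slope
      1 that shifts the waiting period to its place on the time axis.\<close>
    have eq: "indicator {0..<E i k \<omega>} u * G (?c((i, k) := u)) = indicator {?p..<?p + E i k \<omega>} (?p + 1 * u) * F (?p + 1 * u)" for u
    proof (cases "u \<in> {0..<E i k \<omega>}")
      case True
      have "clock_time (?c((i, k) := u)) (i, k) = ?p + u"
        by (simp add: clock_time_eq_sum)
      then show ?thesis
        using True elim i state_before_upd[of i d ?c u k x0] by (simp add: G_def F_def clocks_apply)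
    qed simp
    have "(\<integral>\<^sup>+u. indicator {0..<E i k \<omega>} u * G (?c((i, k) := u)) \<partial>lborel) =
        (\<integral>\<^sup>+s. indicator {?p..<?p + E i k \<omega>} s * F s \<partial>lborel)"
      unfolding eq by (subst nn_integral_real_affine[of _ 1 ?p]) auto
    then show ?case
      by (simp add: F_def clocks_apply[OF i])
  qed
  finally show ?thesis
    unfolding G_def .
qed

text \<open>The union of the waiting periods is kept because it is known to be the whole half-line
  only once accumulation of rings is ruled out, and \<open>AE_finite\<close> does that by means of
  this formula.\<close>

lemma nn_integral_ring_sum:
  assumes i: "i < d"
  shows "(\<integral>\<^sup>+\<omega>. ring_sum d x0 (clocks \<omega>) T i h \<partial>M) =
    (\<integral>\<^sup>+\<omega>. \<integral>\<^sup>+s. indicator (\<Union>k. {(\<Sum>m<k. clocks \<omega> (i, m))..<(\<Sum>m<Suc k. clocks \<omega> (i, m))}) s *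
        (if s \<le> T then h (state_before d x0 (clocks \<omega>) s) else 0) \<partial>lborel \<partial>M)"
proof -
  let ?J = "\<lambda>\<omega> k. {(\<Sum>m<k. clocks \<omega> (i, m))..<(\<Sum>m<Suc k. clocks \<omega> (i, m))}"
  let ?f = "\<lambda>\<omega> s. if s \<le> T then h (state_before d x0 (clocks \<omega>) s) else 0"
  note [measurable] = measurable_clock_time_clocks[OF i] measurable_sum_clocks[OF i]
  have [measurable]: "(\<lambda>\<omega>. h (state_before d x0 (clocks \<omega>) (clock_time (clocks \<omega>) (i, k)))) \<in> borel_measurable M" for k
    by (rule measurable_fun_state_before) (auto intro: measurable_clocks_apply measurable_clock_time_clocks[OF i])
  have m [measurable]: "(\<lambda>p. indicator (?J (fst p) k) (snd p) * ?f (fst p) (snd p)) \<in> borel_measurable (M \<Otimes>\<^sub>M lborel)" for k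
  proof -
    have [measurable]: "Measurable.pred (M \<Otimes>\<^sub>M lborel) (\<lambda>p. snd p \<in> ?J (fst p) k)"
      unfolding atLeastLessThan_iff by measurable
    show ?thesis by measurable
  qed
  have m': "(\<lambda>\<omega>. \<integral>\<^sup>+s. indicator (?J \<omega> k) s * ?f \<omega> s \<partial>lborel) \<in> borel_measurable M" for k
    using lborel.borel_measurable_nn_integral_fst[OF m[of k]] unfolding fst_conv snd_conv .
  have "(\<integral>\<^sup>+\<omega>. ring_sum d x0 (clocks \<omega>) T i h \<partial>M) = (\<Sum>k. \<integral>\<^sup>+\<omega>. \<integral>\<^sup>+s. indicator (?J \<omega> k) s * ?f \<omega> s \<partial>lborel \<partial>M)"
    unfolding ring_sum_def nn_integral_ring[OF i, symmetric] by (rule nn_integral_suminf) measurable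
  also have "\<dots> = (\<integral>\<^sup>+\<omega>. (\<Sum>k. \<integral>\<^sup>+s. indicator (?J \<omega> k) s * ?f \<omega> s \<partial>lborel) \<partial>M)"
    by (rule nn_integral_suminf[symmetric]) (rule m')
  also have "\<dots> = (\<integral>\<^sup>+\<omega>. \<integral>\<^sup>+s. indicator (\<Union>k. ?J \<omega> k) s * ?f \<omega> s \<partial>lborel \<partial>M)"
  proof (rule nn_integral_cong_AE, use AE_positive AE_space in eventually_elim)
    case (elim \<omega>)
    have [measurable]: "(\<lambda>s. h (state_before d x0 (clocks \<omega>) s)) \<in> borel_measurable borel"
      by (rule measurable_fun_state_before) simp_all
    have "(\<Sum>k. \<integral>\<^sup>+s. indicator (?J \<omega> k) s * ?f \<omega> s \<partial>lborel) = (\<integral>\<^sup>+s. (\<Sum>k. indicator (?J \<omega> k) s * ?f \<omega> s) \<partial>lborel)"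
      by (rule nn_integral_suminf[symmetric]) simp
    also have "\<dots> = (\<integral>\<^sup>+s. indicator (\<Union>k. ?J \<omega> k) s * ?f \<omega> s \<partial>lborel)"
      using elim(1) i
      by (intro nn_integral_cong) (subst suminf_indicator[symmetric, OF disjoint_ring_intervals], auto simp: ennreal_suminf_multc)
    finally show ?case .
  qed
  finally show ?thesis .
qed

text \<open>Taking \<open>h\<close> constantly 1, the expected number of rings up to time
  \<open>n\<close> is at most the length of [0, n], so that number is almost surely finite.\<close>

lemma AE_finite: "AE \<omega> in M. \<forall>i<d. \<forall>t. finite {k. clock_time (clocks \<omega>) (i, k) \<le> t}"
proof -
  have "AE \<omega> in M. i < d \<longrightarrow> finite {k. clock_time (clocks \<omega>) (i, k) \<le> real n}" for i n
  proof (cases "i < d")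
    case i: True
    \<comment> \<open>With \<open>h\<close> equal to 1 the sum merely counts rings, so any initial
      configuration will do.\<close>
    let ?R = "\<lambda>\<omega>. ring_sum d (\<lambda>_. 0) (clocks \<omega>) (real n) i (\<lambda>_. 1)"
    note [measurable] = measurable_clock_time_clocks[OF i]
    have "(\<integral>\<^sup>+\<omega>. ?R \<omega> \<partial>M) \<le> (\<integral>\<^sup>+\<omega>. \<integral>\<^sup>+s. indicator {0..real n} s \<partial>lborel \<partial>M)"
      unfolding nn_integral_ring_sum[OF i]
    proof (rule nn_integral_mono_AE, use AE_positive in eventually_elim)
      case (elim \<omega>)
      let ?U = "\<Union>k. {(\<Sum>m<k. clocks \<omega> (i, m))..<(\<Sum>m<Suc k. clocks \<omega> (i, m))}"
      have "?U \<subseteq> {0..}"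
        using elim i by (intro Union_ring_intervals_subset) auto
      then have "indicator ?U s * (if s \<le> real n then 1 else 0) \<le> (indicator {0..real n} s :: ennreal)" for s
        by (cases "s \<in> ?U") (force split: split_indicator simp del: sum.lessThan_Suc UN_iff)+
      then show ?case
        by (intro nn_integral_mono)
    qed
    also have "\<dots> = ennreal (real n)"
      by (simp add: emeasure_space_1)
    finally have "(\<integral>\<^sup>+\<omega>. ?R \<omega> \<partial>M) \<noteq> \<infinity>"
      using ennreal_less_top[of "real n"] by (auto simp: top_unique)
    then have "AE \<omega> in M. ?R \<omega> \<noteq> \<infinity>"
      by (intro nn_integral_PInf_AE) (simp_all add: ring_sum_def)
    then show ?thesis
    proof eventually_elim
      case (elim \<omega>)
      let ?A = "{k. clock_time (clocks \<omega>) (i, k) \<le> real n}"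
      have "?R \<omega> = (\<Sum>k. indicator ?A k)"
        unfolding ring_sum_def by (intro arg_cong[where f=suminf]) (auto simp: fun_eq_iff)
      also have "\<dots> = emeasure (count_space UNIV) ?A"
        by (simp add: nn_integral_count_space_nat[symmetric])
      finally show ?case
        using elim by (auto intro: ccontr)
    qed
  qed simp
  then have "AE \<omega> in M. \<forall>i n. i < d \<longrightarrow> finite {k. clock_time (clocks \<omega>) (i, k) \<le> real n}"
    by (simp add: AE_all_countable)
  then show ?thesis
  proof eventually_elim
    case (elim \<omega>)
    show ?case
    proof (intro allI impI)
      fix i t assume "i < d"
      obtain n where "t \<le> real n" using real_arch_simple by blast
      then have "{k. clock_time (clocks \<omega>) (i, k) \<le> t} \<subseteq> {k. clock_time (clocks \<omega>) (i, k) \<le> real n}"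
        by auto
      then show "finite {k. clock_time (clocks \<omega>) (i, k) \<le> t}"
        using elim \<open>i < d\<close> finite_subset by blast
    qed
  qed
qed

lemma AE_regular: "AE \<omega> in M. regular_clocks d (clocks \<omega>)"
  using AE_positive AE_inj AE_finite by eventually_elim (simp add: regular_clocks_def)

section \<open>Dynkin's formula in expectation\<close>

definition mean :: "(nat \<Rightarrow> int) \<Rightarrow> real \<Rightarrow> ((nat \<Rightarrow> int) \<Rightarrow> ennreal) \<Rightarrow> ennreal" where
  "mean x0 t h = (\<integral>\<^sup>+\<omega>. h (state_at d x0 (clocks \<omega>) t) \<partial>M)"

text \<open>The expectation is taken inside the time integral so that a bound on \<open>mean\<close>
  at each time integrates at once; \<open>cumul_eq\<close> gives the pathwise form.\<close>

definition cumul :: "(nat \<Rightarrow> int) \<Rightarrow> real \<Rightarrow> ((nat \<Rightarrow> int) \<Rightarrow> ennreal) \<Rightarrow> ennreal" where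
  "cumul x0 T h = (\<integral>\<^sup>+s. indicator {0..T} s * mean x0 s h \<partial>lborel)"

lemma measurable_mean [measurable]: "(\<lambda>s. mean x0 s h) \<in> borel_measurable borel"
  using borel_measurable_nn_integral_fst[OF measurable_pair_swap[OF measurable_state_at_pair[of h x0]]]
  by (simp add: mean_def)

lemma cumul_eq:
  "cumul x0 T h = (\<integral>\<^sup>+\<omega>. \<integral>\<^sup>+s. indicator {0..T} s * h (state_at d x0 (clocks \<omega>) s) \<partial>lborel \<partial>M)"
proof -
  interpret P: pair_sigma_finite M lborel ..
  note [measurable] = measurable_state_at_pair[of h x0]
  have "cumul x0 T h = (\<integral>\<^sup>+s. \<integral>\<^sup>+\<omega>. indicator {0..T} s * h (state_at d x0 (clocks \<omega>) s) \<partial>M \<partial>lborel)"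
    unfolding cumul_def mean_def
    by (intro nn_integral_cong nn_integral_cmult[symmetric] measurable_fun_state_at_clocks)
  also have "\<dots> = (\<integral>\<^sup>+\<omega>. \<integral>\<^sup>+s. indicator {0..T} s * h (state_at d x0 (clocks \<omega>) s) \<partial>lborel \<partial>M)"
    by (intro P.Fubini') (unfold case_prod_unfold, measurable)
  finally show ?thesis .
qed

text \<open>The compensator identity. For regular clocks the waiting periods fill the half-line, and
  the left limit differs from the state only at the countably many ring times.\<close>

lemma nn_integral_ring_sum_eq_cumul:
  assumes i: "i < d"
  shows "(\<integral>\<^sup>+\<omega>. ring_sum d x0 (clocks \<omega>) T i h \<partial>M) = cumul x0 T h"
  unfolding nn_integral_ring_sum[OF i] cumul_eq
proof (rule nn_integral_cong_AE, use AE_regular in eventually_elim)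
  case (elim \<omega>)
  then have U: "(\<Union>k. {(\<Sum>m<k. clocks \<omega> (i, m))..<(\<Sum>m<Suc k. clocks \<omega> (i, m))}) = {0..}"
    using i by (intro Union_ring_intervals_eq) (auto simp: regular_clocks_def)
  show ?case
    unfolding U
    by (intro nn_integral_cong_AE, use AE_state_at_eq_state_before[of d x0 "clocks \<omega>"] in eventually_elim)
       (auto split: split_indicator)
qed

lemma measurable_ring_sum:
  assumes i: "i < d"
  shows "(\<lambda>\<omega>. ring_sum d x0 (clocks \<omega>) T i h) \<in> borel_measurable M"
proof -
  note [measurable] = measurable_clock_time_clocks[OF i]
  have [measurable]: "(\<lambda>\<omega>. h (state_before d x0 (clocks \<omega>) (clock_time (clocks \<omega>) (i, k)))) \<in> borel_measurable M" for k
    by (rule measurable_fun_state_before) (auto intro: measurable_clocks_apply measurable_clock_time_clocks[OF i])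
  show ?thesis unfolding ring_sum_def by measurable
qed

lemma nn_integral_sum_ring_sum:
  "(\<integral>\<^sup>+\<omega>. (\<Sum>i<d. ring_sum d x0 (clocks \<omega>) T i (a i)) \<partial>M) = (\<Sum>i<d. cumul x0 T (a i))"
  by (subst nn_integral_sum) (auto simp: measurable_ring_sum nn_integral_ring_sum_eq_cumul)

text \<open>Dynkin's formula as an inequality for the generator that applies every push at rate one:
  the pathwise telescoping is integrated and each ring sum becomes a time integral.\<close>

lemma dynkin_le:
  assumes step: "\<And>x i. admissible d x0 x \<Longrightarrow> i < d \<Longrightarrow> \<Phi> (push d x i) + b i x \<le> \<Phi> x + a i x"
    and x0: "admissible d x0 x0"
  shows "mean x0 T \<Phi> + (\<Sum>i<d. cumul x0 T (b i)) \<le> \<Phi> x0 + (\<Sum>i<d. cumul x0 T (a i))"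
proof -
  have "mean x0 T \<Phi> + (\<Sum>i<d. cumul x0 T (b i)) =
      (\<integral>\<^sup>+\<omega>. \<Phi> (state_at d x0 (clocks \<omega>) T) + (\<Sum>i<d. ring_sum d x0 (clocks \<omega>) T i (b i)) \<partial>M)"
    unfolding nn_integral_sum_ring_sum[symmetric] mean_def
    by (rule nn_integral_add[symmetric]) (auto intro!: measurable_fun_state_at_clocks borel_measurable_sum measurable_ring_sum)
  also have "\<dots> \<le> (\<integral>\<^sup>+\<omega>. \<Phi> x0 + (\<Sum>i<d. ring_sum d x0 (clocks \<omega>) T i (a i)) \<partial>M)"
    by (intro nn_integral_mono_AE, use AE_regular in eventually_elim) (intro state_at_le step x0)
  also have "\<dots> = \<Phi> x0 + (\<Sum>i<d. cumul x0 T (a i))"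
    unfolding nn_integral_sum_ring_sum[symmetric]
    by (subst nn_integral_add) (auto intro!: borel_measurable_sum measurable_ring_sum simp: emeasure_space_1)
  finally show ?thesis .
qed

lemma dynkin_ge:
  assumes step: "\<And>x i. admissible d x0 x \<Longrightarrow> i < d \<Longrightarrow> \<Phi> x + a i x \<le> \<Phi> (push d x i) + b i x"
    and x0: "admissible d x0 x0"
  shows "\<Phi> x0 + (\<Sum>i<d. cumul x0 T (a i)) \<le> mean x0 T \<Phi> + (\<Sum>i<d. cumul x0 T (b i))"
proof -
  have "\<Phi> x0 + (\<Sum>i<d. cumul x0 T (a i)) = (\<integral>\<^sup>+\<omega>. \<Phi> x0 + (\<Sum>i<d. ring_sum d x0 (clocks \<omega>) T i (a i)) \<partial>M)"
    unfolding nn_integral_sum_ring_sum[symmetric]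
    by (subst nn_integral_add) (auto intro!: borel_measurable_sum measurable_ring_sum simp: emeasure_space_1)
  also have "\<dots> \<le> (\<integral>\<^sup>+\<omega>. \<Phi> (state_at d x0 (clocks \<omega>) T) + (\<Sum>i<d. ring_sum d x0 (clocks \<omega>) T i (b i)) \<partial>M)"
    by (intro nn_integral_mono_AE, use AE_regular in eventually_elim) (intro state_at_ge step x0)
  also have "\<dots> = mean x0 T \<Phi> + (\<Sum>i<d. cumul x0 T (b i))"
    unfolding nn_integral_sum_ring_sum[symmetric] mean_def
    by (rule nn_integral_add) (auto intro!: measurable_fun_state_at_clocks borel_measurable_sum measurable_ring_sum)
  finally show ?thesis .
qed

end

section \<open>The process from a fixed ordered configuration\<close>

locale pushtasep_process = exponential_clocks M d E
  for M :: "'a measure" and d :: nat and E :: "nat \<Rightarrow> nat \<Rightarrow> 'a \<Rightarrow> real" +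
  fixes x0 :: "nat \<Rightarrow> int"
  assumes d_ge: "2 \<le> d"
    and ordered: "\<And>i. Suc i < d \<Longrightarrow> x0 i < x0 (Suc i)"
begin

lemma admissible_x0: "admissible d x0 x0"
proof -
  have "0 \<le> gap x0 j" if "Suc j < d" for j
    using ordered[OF that] by (simp add: gap_def)
  then show ?thesis by (simp add: admissible_def)
qed

abbreviation EE :: "real \<Rightarrow> ((nat \<Rightarrow> int) \<Rightarrow> ennreal) \<Rightarrow> ennreal" where
  "EE \<equiv> mean x0"

abbreviation CC :: "real \<Rightarrow> ((nat \<Rightarrow> int) \<Rightarrow> ennreal) \<Rightarrow> ennreal" where
  "CC \<equiv> cumul x0"

lemma mean_mono: "(\<And>x. admissible d x0 x \<Longrightarrow> f x \<le> g x) \<Longrightarrow> EE t f \<le> EE t g"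
  unfolding mean_def by (intro nn_integral_mono) (simp add: admissible_state_at admissible_x0)

lemma mean_add: "EE t (\<lambda>x. f x + g x) = EE t f + EE t g"
  unfolding mean_def by (intro nn_integral_add measurable_fun_state_at_clocks)

lemma mean_cmult: "EE t (\<lambda>x. c * f x) = c * EE t f"
  unfolding mean_def by (intro nn_integral_cmult measurable_fun_state_at_clocks)

lemma mean_sum: "EE t (\<lambda>x. \<Sum>j\<in>A. f j x) = (\<Sum>j\<in>A. EE t (f j))"
  unfolding mean_def by (intro nn_integral_sum measurable_fun_state_at_clocks)

lemma mean_const: "EE t (\<lambda>_. c) = c"
  unfolding mean_def by (simp add: emeasure_space_1)

lemma cumul_mono: "(\<And>x. admissible d x0 x \<Longrightarrow> f x \<le> g x) \<Longrightarrow> CC T f \<le> CC T g"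
  unfolding cumul_def by (intro nn_integral_mono mult_left_mono mean_mono) auto

lemma cumul_add: "CC T (\<lambda>x. f x + g x) = CC T f + CC T g"
  unfolding cumul_def mean_add distrib_left by (intro nn_integral_add) auto

lemma cumul_sum: "CC T (\<lambda>x. \<Sum>j\<in>A. f j x) = (\<Sum>j\<in>A. CC T (f j))"
  unfolding cumul_def mean_sum sum_distrib_left by (intro nn_integral_sum) auto

lemma cumul_le:
  assumes "0 \<le> T" "0 \<le> c" "\<And>s. 0 \<le> s \<Longrightarrow> s \<le> T \<Longrightarrow> EE s f \<le> ennreal c"
  shows "CC T f \<le> ennreal (c * T)"
proof -
  have "CC T f \<le> (\<integral>\<^sup>+s. ennreal c * indicator {0..T} s \<partial>lborel)"
    unfolding cumul_def using assms(3) by (intro nn_integral_mono) (auto split: split_indicator)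
  also have "\<dots> = ennreal (c * T)"
    using assms by (simp add: nn_integral_cmult_indicator ennreal_mult)
  finally show ?thesis .
qed

lemma cumul_const:
  assumes "0 \<le> T" "0 \<le> c"
  shows "CC T (\<lambda>_. ennreal c) = ennreal (c * T)"
proof -
  have "CC T (\<lambda>_. ennreal c) = (\<integral>\<^sup>+s. ennreal c * indicator {0..T} s \<partial>lborel)"
    unfolding cumul_def mean_const by (simp add: mult.commute)
  also have "\<dots> = ennreal (c * T)"
    using assms by (simp add: nn_integral_cmult_indicator ennreal_mult)
  finally show ?thesis .
qed

lemma cumul_one: "0 \<le> T \<Longrightarrow> CC T (\<lambda>_. 1) = ennreal T"
  using cumul_const[of T 1] by simp

lemma cumul_zero: "CC T (\<lambda>_. 0) = 0"
  by (simp add: cumul_def mean_const)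

lemma sum_cumul_single:
  assumes "p < d"
  shows "(\<Sum>i<d. CC T (\<lambda>x. if i = p then A x else 0)) = CC T A"
proof -
  have "(\<Sum>i<d. CC T (\<lambda>x. if i = p then A x else 0)) = (\<Sum>i<d. if i = p then CC T A else 0)"
    by (intro sum.cong) (auto simp: cumul_zero)
  then show ?thesis using assms by simp
qed

subsection \<open>Moments of the gaps\<close>

definition gap_pow :: "nat \<Rightarrow> nat \<Rightarrow> (nat \<Rightarrow> int) \<Rightarrow> ennreal" where
  "gap_pow n j x = ennreal (real_of_int (gap x j) ^ n)"

definition gap_up :: "nat \<Rightarrow> nat \<Rightarrow> (nat \<Rightarrow> int) \<Rightarrow> ennreal" where
  "gap_up n j x = ennreal ((real_of_int (gap x j) + 1) ^ n - real_of_int (gap x j) ^ n)"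

text \<open>At gap 0 a ring of clock \<open>j\<close> pushes the neighbour along and the gap stays,
  so the loss is 0, whereas the difference of powers would give 1 there for odd
  \<open>n\<close>.\<close>

definition gap_down :: "nat \<Rightarrow> nat \<Rightarrow> (nat \<Rightarrow> int) \<Rightarrow> ennreal" where
  "gap_down n j x = (if gap x j = 0 then 0
    else ennreal (real_of_int (gap x j) ^ n - (real_of_int (gap x j) - 1) ^ n))"

definition gap_zero :: "nat \<Rightarrow> (nat \<Rightarrow> int) \<Rightarrow> ennreal" where
  "gap_zero j x = (if gap x j = 0 then 1 else 0)"

lemma gap_eq_0_or_ge_1:
  assumes "admissible d x0 x" "Suc j < d"
  shows "real_of_int (gap x j) = 0 \<or> 1 \<le> real_of_int (gap x j)"
  using admissible_gap[OF assms] by (cases "gap x j = 0") auto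

text \<open>With \<open>v\<close> the gap, the gain \<open>2 * v + 1\<close> exceeds the loss
  \<open>2 * v - 1\<close> by 2 off the boundary; at 0 the gain is 1 and there is no loss. The net
  rate is thus always between 1 and 2.\<close>

lemma gap_square_increments:
  assumes "admissible d x0 x" "Suc j < d"
  shows "gap_up 2 j x \<le> ennreal 2 + gap_down 2 j x" "gap_down 2 j x + 1 \<le> gap_up 2 j x"
    "gap_down 2 j x \<le> ennreal 2 * gap_pow 1 j x"
proof -
  define v where "v = real_of_int (gap x j)"
  have v: "v = 0 \<or> 1 \<le> v"
    unfolding v_def by (rule gap_eq_0_or_ge_1[OF assms])
  have up: "gap_up 2 j x = ennreal (2 * v + 1)"
    by (simp add: gap_up_def v_def power2_eq_square algebra_simps)
  have down: "gap_down 2 j x = (if v = 0 then 0 else ennreal (2 * v - 1))"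
    by (simp add: gap_down_def v_def power2_eq_square algebra_simps)
  have pow: "gap_pow 1 j x = ennreal v"
    by (simp add: gap_pow_def v_def)
  show "gap_up 2 j x \<le> ennreal 2 + gap_down 2 j x"
  proof (cases "v = 0")
    case False
    then have "ennreal 2 + gap_down 2 j x = ennreal (2 + (2 * v - 1))"
      unfolding down using v by (subst ennreal_plus) auto
    then show ?thesis
      unfolding up by (auto intro!: ennreal_leI)
  qed (simp add: up down)
  show "gap_down 2 j x + 1 \<le> gap_up 2 j x"
  proof (cases "v = 0")
    case False
    then have "gap_down 2 j x + 1 = ennreal ((2 * v - 1) + 1)"
      unfolding down using v by (subst ennreal_plus) auto
    then show ?thesis
      unfolding up by (auto intro!: ennreal_leI)
  qed (simp add: up down)
  have "ennreal 2 * gap_pow 1 j x = ennreal (2 * v)"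
    unfolding pow using v by (subst ennreal_mult) auto
  then show "gap_down 2 j x \<le> ennreal 2 * gap_pow 1 j x"
    unfolding down by (auto intro!: ennreal_leI)
qed

lemma gap_pow_push_right:
  assumes "admissible d x0 x" "Suc j < d"
  shows "gap_pow n j (push d x (Suc j)) = gap_pow n j x + gap_up n j x"
proof -
  have w: "0 \<le> real_of_int (gap x j)"
    using admissible_gap[OF assms] by simp
  then have "real_of_int (gap x j) ^ n \<le> (real_of_int (gap x j) + 1) ^ n"
    by (intro power_mono) auto
  then show ?thesis
    using w assms(2) by (simp add: gap_pow_def gap_up_def gap_push_right ennreal_plus[symmetric] del: ennreal_plus)
qed

lemma gap_pow_push_left:
  assumes "admissible d x0 x" "Suc j < d"
  shows "gap_pow n j (push d x j) + gap_down n j x = gap_pow n j x"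
proof (cases "gap x j = 0")
  case True
  then show ?thesis using assms(2) by (simp add: gap_pow_def gap_down_def gap_push_left)
next
  case False
  with admissible_gap[OF assms] have w: "1 \<le> real_of_int (gap x j)"
    by linarith
  then have "(real_of_int (gap x j) - 1) ^ n \<le> real_of_int (gap x j) ^ n"
    by (intro power_mono) auto
  then show ?thesis
    using w assms(2) False by (simp add: gap_pow_def gap_down_def gap_push_left ennreal_plus[symmetric] del: ennreal_plus)
qed

lemma gap_pow_push_far_right:
  "Suc j < i \<Longrightarrow> i < d \<Longrightarrow> gap_pow n j (push d x i) = gap_pow n j x"
  by (simp add: gap_pow_def gap_push_far_right)

lemma gap_pow_push_far_left:
  assumes "admissible d x0 x" "Suc j < d" "i < j"
  shows "gap_pow n j (push d x i) \<le> gap_pow n j x"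
proof -
  have "0 \<le> gap x j"
    by (rule admissible_gap[OF assms(1,2)])
  moreover have "0 \<le> gap (push d x i) j"
    using assms by (intro admissible_gap[OF admissible_push]) auto
  moreover have "gap (push d x i) j \<le> gap x j"
    using gap_push_far_left[OF assms(3,2), of x] by auto
  ultimately show ?thesis
    unfolding gap_pow_def by (intro ennreal_leI power_mono) auto
qed

lemma gap_dynkin_le:
  assumes j: "Suc j < d"
  shows "EE T (gap_pow n j) + CC T (gap_down n j) \<le> gap_pow n j x0 + CC T (gap_up n j)"
proof -
  have "EE T (gap_pow n j) + (\<Sum>i<d. CC T (\<lambda>x. if i = j then gap_down n j x else 0))
      \<le> gap_pow n j x0 + (\<Sum>i<d. CC T (\<lambda>x. if i = Suc j then gap_up n j x else 0))"
  proof (rule dynkin_le[OF _ admissible_x0])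
    fix x i assume x: "admissible d x0 x" and i: "i < d"
    consider "i = Suc j" | "i = j" | "Suc j < i" | "i < j" by linarith
    then show "gap_pow n j (push d x i) + (if i = j then gap_down n j x else 0)
        \<le> gap_pow n j x + (if i = Suc j then gap_up n j x else 0)"
      by cases (use gap_pow_push_right[OF x j] gap_pow_push_left[OF x j] gap_pow_push_far_right[of j i]
          gap_pow_push_far_left[OF x j] i in auto)
  qed
  then show ?thesis
    using j by (simp add: sum_cumul_single)
qed

text \<open>What is discarded in \<open>gap_dynkin_le\<close> are the losses caused by clocks to the
  left of \<open>j\<close>. For the first gap there are none, so the reverse inequality
  holds.\<close>

lemma first_gap_dynkin_ge:
  shows "gap_pow n 0 x0 + CC T (gap_up n 0) \<le> EE T (gap_pow n 0) + CC T (gap_down n 0)"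
proof -
  have j: "Suc 0 < d" using d_ge by simp
  have "gap_pow n 0 x0 + (\<Sum>i<d. CC T (\<lambda>x. if i = Suc 0 then gap_up n 0 x else 0))
      \<le> EE T (gap_pow n 0) + (\<Sum>i<d. CC T (\<lambda>x. if i = 0 then gap_down n 0 x else 0))"
  proof (rule dynkin_ge[OF _ admissible_x0])
    fix x i assume x: "admissible d x0 x" and i: "i < d"
    consider "i = Suc 0" | "i = 0" | "Suc 0 < i" by linarith
    then show "gap_pow n 0 x + (if i = Suc 0 then gap_up n 0 x else 0)
        \<le> gap_pow n 0 (push d x i) + (if i = 0 then gap_down n 0 x else 0)"
      by cases (use gap_pow_push_right[OF x j] gap_pow_push_left[OF x j] gap_pow_push_far_right[of 0 i] i in auto)
  qed
  moreover have "(\<Sum>i<d. CC T (\<lambda>x. if i = 0 then gap_down n 0 x else 0)) = CC T (gap_down n 0)"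
    using d_ge by (intro sum_cumul_single) simp
  ultimately show ?thesis
    using j by (simp add: sum_cumul_single)
qed

text \<open>For the first power, gain and loss are both 1 off the boundary and cancel; only the gain
  survives at 0. The boundary time thus plays the part of local time in a reflected walk.\<close>

lemma cumul_gap_zero_ge:
  assumes j: "Suc j < d" and T: "0 \<le> T"
  shows "EE T (gap_pow 1 j) \<le> gap_pow 1 j x0 + CC T (gap_zero j)"
proof -
  have "EE T (gap_pow 1 j) + CC T (gap_down 1 j) \<le> gap_pow 1 j x0 + CC T (gap_up 1 j)"
    by (rule gap_dynkin_le[OF j])
  also have "CC T (gap_up 1 j) \<le> CC T (\<lambda>x. gap_zero j x + gap_down 1 j x)"
    by (intro cumul_mono) (simp add: gap_up_def gap_zero_def gap_down_def)
  finally have "CC T (gap_down 1 j) + EE T (gap_pow 1 j) \<le> CC T (gap_down 1 j) + (gap_pow 1 j x0 + CC T (gap_zero j))"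
    by (simp add: cumul_add add_ac)
  moreover have "CC T (gap_down 1 j) \<le> ennreal (1 * T)"
    using T by (subst cumul_const[symmetric]) (auto intro!: cumul_mono simp: gap_down_def)
  then have "CC T (gap_down 1 j) \<noteq> \<infinity>"
    by (auto simp: top_unique)
  ultimately show ?thesis
    by (simp add: ennreal_add_left_cancel_le)
qed

definition w0 :: "nat \<Rightarrow> real" where
  "w0 j = real_of_int (gap x0 j)"

lemma w0_nonneg: "Suc j < d \<Longrightarrow> 0 \<le> w0 j"
  using admissible_gap[OF admissible_x0] by (simp add: w0_def)

lemma gap_pow_x0: "gap_pow n j x0 = ennreal (w0 j ^ n)"
  by (simp add: gap_pow_def w0_def)

text \<open>A crude bound that serves to make the cumulated loss of the square finite, so that it
  may be cancelled.\<close>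

lemma mean_gap_le_linear:
  assumes j: "Suc j < d" and T: "0 \<le> T"
  shows "EE T (gap_pow 1 j) \<le> ennreal (w0 j + T)"
proof -
  have "EE T (gap_pow 1 j) \<le> gap_pow 1 j x0 + CC T (gap_zero j)"
    by (rule cumul_gap_zero_ge[OF assms])
  also have "\<dots> \<le> gap_pow 1 j x0 + CC T (\<lambda>_. 1)"
    by (intro add_left_mono cumul_mono) (simp add: gap_zero_def)
  finally show ?thesis
    using w0_nonneg[OF j] T by (simp add: cumul_one gap_pow_x0 ennreal_plus)
qed

lemma cumul_gap_square_down_finite:
  assumes j: "Suc j < d" and T: "0 \<le> T"
  shows "CC T (gap_down 2 j) \<noteq> \<infinity>"
proof -
  have "CC T (gap_down 2 j) \<le> ennreal (2 * (w0 j + T) * T)"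
  proof (rule cumul_le)
    fix s assume s: "0 \<le> s" "s \<le> T"
    have "EE s (gap_down 2 j) \<le> EE s (\<lambda>x. ennreal 2 * gap_pow 1 j x)"
      by (intro mean_mono gap_square_increments j)
    also have "\<dots> = ennreal 2 * EE s (gap_pow 1 j)"
      by (rule mean_cmult)
    also have "\<dots> \<le> ennreal 2 * ennreal (w0 j + s)"
      by (intro mult_left_mono mean_gap_le_linear j s) simp
    also have "\<dots> \<le> ennreal (2 * (w0 j + T))"
      using s w0_nonneg[OF j] by (subst ennreal_mult[symmetric]) (auto intro!: ennreal_leI)
    finally show "EE s (gap_down 2 j) \<le> ennreal (2 * (w0 j + T))" .
  qed (use T w0_nonneg[OF j] in auto)
  then show ?thesis
    by (auto simp: top_unique)
qed

lemma mean_gap_square_le: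
  assumes j: "Suc j < d" and T: "0 \<le> T"
  shows "EE T (gap_pow 2 j) \<le> ennreal ((w0 j)\<^sup>2 + 2 * T)"
proof -
  have "EE T (gap_pow 2 j) + CC T (gap_down 2 j) \<le> gap_pow 2 j x0 + CC T (gap_up 2 j)"
    by (rule gap_dynkin_le[OF j])
  also have "CC T (gap_up 2 j) \<le> CC T (\<lambda>x. ennreal 2 + gap_down 2 j x)"
    by (intro cumul_mono gap_square_increments j)
  also have "\<dots> = ennreal (2 * T) + CC T (gap_down 2 j)"
    using T by (simp only: cumul_add cumul_const)
  finally have "CC T (gap_down 2 j) + EE T (gap_pow 2 j) \<le> CC T (gap_down 2 j) + (gap_pow 2 j x0 + ennreal (2 * T))"
    by (simp add: add_ac)
  then have "EE T (gap_pow 2 j) \<le> gap_pow 2 j x0 + ennreal (2 * T)"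
    using cumul_gap_square_down_finite[OF assms] by (simp add: ennreal_add_left_cancel_le)
  also have "\<dots> = ennreal ((w0 j)\<^sup>2 + 2 * T)"
    using T unfolding gap_pow_x0 by (intro ennreal_plus[symmetric]) auto
  finally show ?thesis .
qed

text \<open>A pointwise substitute for Cauchy-Schwarz: \<open>2 * v * r\<close> is at most the sum
  of the squares, and with \<open>r = sqrt T\<close> the second moment bound makes both terms of
  order \<open>sqrt T\<close>. The bound is uniform in \<open>s\<close> up to \<open>T\<close>, so
  it can be integrated.\<close>

lemma mean_gap_le:
  assumes j: "Suc j < d" and T: "0 \<le> s" "s \<le> T" "1 \<le> T"
  shows "EE s (gap_pow 1 j) \<le> ennreal (((w0 j)\<^sup>2 + 3) * sqrt T)"
proof -
  define r where "r = sqrt T"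
  have r: "1 \<le> r" "r\<^sup>2 = T" using T by (auto simp: r_def)
  have "EE s (gap_pow 1 j) \<le> EE s (\<lambda>x. ennreal (1 / r) * gap_pow 2 j x + ennreal r)"
  proof (intro mean_mono)
    fix x assume "admissible d x0 x"
    define v where "v = real_of_int (gap x j)"
    have v: "0 \<le> v" using admissible_gap[OF \<open>admissible d x0 x\<close> j] by (simp add: v_def)
    have "v * r \<le> v\<^sup>2 + r\<^sup>2"
      using sum_squares_bound[of v r] mult_nonneg_nonneg[of v r] v r by linarith
    then have "v \<le> 1 / r * v\<^sup>2 + r"
      using r by (simp add: field_simps power2_eq_square)
    then have "ennreal v \<le> ennreal (1 / r * v\<^sup>2 + r)"
      by (rule ennreal_leI)
    also have "\<dots> = ennreal (1 / r) * ennreal (v\<^sup>2) + ennreal r"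
      using r v by (simp add: ennreal_mult[symmetric])
    finally show "gap_pow 1 j x \<le> ennreal (1 / r) * gap_pow 2 j x + ennreal r"
      by (simp add: gap_pow_def v_def)
  qed
  also have "\<dots> = ennreal (1 / r) * EE s (gap_pow 2 j) + ennreal r"
    by (simp add: mean_add mean_cmult mean_const)
  also have "\<dots> \<le> ennreal (1 / r) * ennreal ((w0 j)\<^sup>2 + 2 * s) + ennreal r"
    by (intro add_right_mono mult_left_mono mean_gap_square_le j T) simp
  also have "\<dots> = ennreal (1 / r * ((w0 j)\<^sup>2 + 2 * s) + r)"
    using r T by (subst ennreal_mult[symmetric]) auto
  also have "\<dots> \<le> ennreal (((w0 j)\<^sup>2 + 3) * r)"
  proof (rule ennreal_leI)
    have "(w0 j)\<^sup>2 * 1 \<le> (w0 j)\<^sup>2 * r\<^sup>2"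
      using r by (intro mult_left_mono) auto
    then have "(w0 j)\<^sup>2 + 2 * s \<le> ((w0 j)\<^sup>2 + 2) * r\<^sup>2"
      using r T by (simp add: algebra_simps)
    then show "1 / r * ((w0 j)\<^sup>2 + 2 * s) + r \<le> ((w0 j)\<^sup>2 + 3) * r"
      using r by (simp add: field_simps power2_eq_square)
  qed
  finally show ?thesis unfolding r_def .
qed

lemma mean_gap_cube_le:
  assumes j: "Suc j < d" and T: "1 \<le> T"
  shows "EE T (gap_pow 3 j) \<le> ennreal ((w0 j ^ 3 + 6 * (w0 j)\<^sup>2 + 19) * (T * sqrt T))"
proof -
  have T0: "0 \<le> T" using T by simp
  let ?m = "((w0 j)\<^sup>2 + 3) * sqrt T"
  have m: "0 \<le> ?m" using T by simp
  have "EE T (gap_pow 3 j) + CC T (gap_down 3 j) \<le> gap_pow 3 j x0 + CC T (gap_up 3 j)"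
    by (rule gap_dynkin_le[OF j])
  \<comment> \<open>Gain minus loss of the cube is \<open>6 * v\<close> off the boundary and 1 at 0,
    hence at most \<open>6 * v + 1\<close> in both cases.\<close>
  also have "CC T (gap_up 3 j) \<le> CC T (\<lambda>x. (ennreal 6 * gap_pow 1 j x + ennreal 1) + gap_down 3 j x)"
  proof (intro cumul_mono)
    fix x assume "admissible d x0 x"
    define v where "v = real_of_int (gap x j)"
    have v: "v = 0 \<or> 1 \<le> v"
      unfolding v_def by (rule gap_eq_0_or_ge_1[OF \<open>admissible d x0 x\<close> j])
    have v0: "gap x j = 0 \<longleftrightarrow> v = 0" by (simp add: v_def)
    have "gap_up 3 j x = ennreal (3 * v\<^sup>2 + 3 * v + 1)"
      by (simp add: gap_up_def v_def[symmetric] power2_eq_square power3_eq_cube algebra_simps)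
    also have "\<dots> \<le> ennreal (6 * v + 1) + gap_down 3 j x"
    proof (cases "v = 0")
      case False
      with v have v1: "1 \<le> v" by simp
      have "gap_down 3 j x = ennreal (3 * v\<^sup>2 - 3 * v + 1)"
        using False by (simp add: gap_down_def v0 v_def[symmetric] power2_eq_square power3_eq_cube algebra_simps)
      moreover have "v * 1 \<le> v\<^sup>2"
        unfolding power2_eq_square using v1 by (intro mult_left_mono) auto
      ultimately show ?thesis
        using v1 by (simp add: ennreal_plus[symmetric] del: ennreal_plus)
    qed simp
    also have "ennreal (6 * v + 1) = ennreal 6 * gap_pow 1 j x + ennreal 1"
      unfolding gap_pow_def v_def[symmetric] power_one_right using v
      by (subst ennreal_mult[symmetric]) (auto intro: ennreal_plus)
    finally show "gap_up 3 j x \<le> (ennreal 6 * gap_pow 1 j x + ennreal 1) + gap_down 3 j x" .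
  qed
  also have "\<dots> = CC T (\<lambda>x. ennreal 6 * gap_pow 1 j x + ennreal 1) + CC T (gap_down 3 j)"
    by (rule cumul_add)
  also have "CC T (\<lambda>x. ennreal 6 * gap_pow 1 j x + ennreal 1) \<le> ennreal ((6 * ?m + 1) * T)"
  proof (rule cumul_le)
    fix s assume s: "0 \<le> s" "s \<le> T"
    have "EE s (\<lambda>x. ennreal 6 * gap_pow 1 j x + ennreal 1) = ennreal 6 * EE s (gap_pow 1 j) + ennreal 1"
      by (simp only: mean_add mean_cmult mean_const)
    also have "\<dots> \<le> ennreal 6 * ennreal ?m + ennreal 1"
      by (intro add_right_mono mult_left_mono mean_gap_le j s T) simp
    also have "\<dots> = ennreal (6 * ?m + 1)"
      using m by (subst ennreal_mult[symmetric]) (auto intro: ennreal_plus[symmetric])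
    finally show "EE s (\<lambda>x. ennreal 6 * gap_pow 1 j x + ennreal 1) \<le> ennreal (6 * ?m + 1)" .
  qed (use T m in auto)
  finally have "CC T (gap_down 3 j) + EE T (gap_pow 3 j)
      \<le> CC T (gap_down 3 j) + (gap_pow 3 j x0 + ennreal ((6 * ?m + 1) * T))"
    by (simp add: add_ac)
  \<comment> \<open>Needed for cancelling: the loss of the cube is at most three times the square,
    whose mean is already bounded.\<close>
  moreover have "CC T (gap_down 3 j) \<le> ennreal (3 * ((w0 j)\<^sup>2 + 2 * T) * T)"
  proof (rule cumul_le)
    fix s assume s: "0 \<le> s" "s \<le> T"
    have "EE s (gap_down 3 j) \<le> EE s (\<lambda>x. ennreal 3 * gap_pow 2 j x)"
    proof (intro mean_mono)
      fix x assume "admissible d x0 x"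
      define v where "v = real_of_int (gap x j)"
      have v: "v = 0 \<or> 1 \<le> v"
        unfolding v_def by (rule gap_eq_0_or_ge_1[OF \<open>admissible d x0 x\<close> j])
      have v0: "gap x j = 0 \<longleftrightarrow> v = 0" by (simp add: v_def)
      have "ennreal 3 * gap_pow 2 j x = ennreal (3 * v\<^sup>2)"
        unfolding gap_pow_def v_def[symmetric] by (subst ennreal_mult) auto
      moreover have "gap_down 3 j x \<le> ennreal (3 * v\<^sup>2)"
        unfolding gap_down_def v0 v_def[symmetric] using v
        by (auto simp: power2_eq_square power3_eq_cube algebra_simps intro!: ennreal_leI)
      ultimately show "gap_down 3 j x \<le> ennreal 3 * gap_pow 2 j x" by simp
    qed
    also have "\<dots> = ennreal 3 * EE s (gap_pow 2 j)"
      by (rule mean_cmult)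
    also have "\<dots> \<le> ennreal 3 * ennreal ((w0 j)\<^sup>2 + 2 * s)"
      by (intro mult_left_mono mean_gap_square_le j s) simp
    also have "\<dots> \<le> ennreal (3 * ((w0 j)\<^sup>2 + 2 * T))"
      using s by (subst ennreal_mult[symmetric]) (auto intro!: ennreal_leI)
    finally show "EE s (gap_down 3 j) \<le> ennreal (3 * ((w0 j)\<^sup>2 + 2 * T))" .
  qed (use T in auto)
  then have "CC T (gap_down 3 j) \<noteq> \<infinity>"
    by (auto simp: top_unique)
  ultimately have "EE T (gap_pow 3 j) \<le> gap_pow 3 j x0 + ennreal ((6 * ?m + 1) * T)"
    by (simp add: ennreal_add_left_cancel_le)
  also have "\<dots> = ennreal (w0 j ^ 3 + (6 * ?m + 1) * T)"
    using T m w0_nonneg[OF j] unfolding gap_pow_x0 by (intro ennreal_plus[symmetric]) auto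
  \<comment> \<open>The coefficient 6 of \<open>v\<close> multiplies the constant of
    \<open>mean_gap_le\<close>, which accounts for 6 times the square of \<open>w0 j\<close> plus
    18; the remaining 1 is the constant rate.\<close>
  also have "\<dots> \<le> ennreal ((w0 j ^ 3 + 6 * (w0 j)\<^sup>2 + 19) * (T * sqrt T))"
  proof (rule ennreal_leI)
    have 1: "T * 1 \<le> T * sqrt T" using T by (intro mult_left_mono) auto
    then have 2: "1 \<le> T * sqrt T" using T by linarith
    have "w0 j ^ 3 * 1 \<le> w0 j ^ 3 * (T * sqrt T)"
      using 2 w0_nonneg[OF j] by (intro mult_left_mono) auto
    with 1 show "w0 j ^ 3 + (6 * ?m + 1) * T \<le> (w0 j ^ 3 + 6 * (w0 j)\<^sup>2 + 19) * (T * sqrt T)"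
      by (simp add: algebra_simps)
  qed
  finally show ?thesis .
qed

lemma mean_first_gap_square_ge:
  assumes T: "0 \<le> T"
  shows "ennreal T \<le> EE T (gap_pow 2 0)"
proof -
  have j: "Suc 0 < d" using d_ge by simp
  have "CC T (gap_down 2 0) + ennreal T = CC T (\<lambda>x. gap_down 2 0 x + 1)"
    by (simp add: cumul_add cumul_one T)
  also have "\<dots> \<le> CC T (gap_up 2 0)"
    by (intro cumul_mono gap_square_increments j)
  also have "\<dots> \<le> gap_pow 2 0 x0 + CC T (gap_up 2 0)" by simp
  also have "\<dots> \<le> EE T (gap_pow 2 0) + CC T (gap_down 2 0)"
    by (rule first_gap_dynkin_ge)
  finally have "CC T (gap_down 2 0) + ennreal T \<le> CC T (gap_down 2 0) + EE T (gap_pow 2 0)"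
    by (simp add: add_ac)
  then show ?thesis
    using cumul_gap_square_down_finite[OF j T] by (simp add: ennreal_add_left_cancel_le)
qed

text \<open>A pointwise substitute for Hoelder: expanding the nonnegative
  \<open>v * (1 - v / a)^2\<close> bounds \<open>2 / a\<close> times the square by \<open>v\<close>
  plus the cube over \<open>a^2\<close>. The choice of \<open>a\<close> as \<open>C * sqrt T\<close>
  makes the cube term at most half of the lower bound for the left side.\<close>

lemma mean_first_gap_ge:
  assumes T: "1 \<le> T"
  shows "ennreal (sqrt T / (w0 0 ^ 3 + 6 * (w0 0)\<^sup>2 + 19)) \<le> EE T (gap_pow 1 0)"
proof -
  have j: "Suc 0 < d" using d_ge by simp
  define C where "C = w0 0 ^ 3 + 6 * (w0 0)\<^sup>2 + 19"
  define r where "r = sqrt T"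
  have r: "1 \<le> r" "T = r\<^sup>2" using T by (auto simp: r_def)
  have C: "0 < C"
    using w0_nonneg[OF j] by (simp add: C_def add_nonneg_pos)
  define a where "a = C * r"
  have a: "0 < a" using C r by (simp add: a_def)
  have "ennreal (2 / a * T) = ennreal (2 / a) * ennreal T"
    using a T by (intro ennreal_mult) auto
  also have "\<dots> \<le> ennreal (2 / a) * EE T (gap_pow 2 0)"
    using T by (intro mult_left_mono mean_first_gap_square_ge) auto
  also have "\<dots> = EE T (\<lambda>x. ennreal (2 / a) * gap_pow 2 0 x)"
    by (rule mean_cmult[symmetric])
  also have "\<dots> \<le> EE T (\<lambda>x. gap_pow 1 0 x + ennreal (1 / a\<^sup>2) * gap_pow 3 0 x)"
  proof (intro mean_mono)
    fix x assume "admissible d x0 x"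
    define v where "v = real_of_int (gap x 0)"
    have v: "0 \<le> v" using admissible_gap[OF \<open>admissible d x0 x\<close> j] by (simp add: v_def)
    have "0 \<le> v * (1 - v / a)\<^sup>2" using v by simp
    also have "\<dots> = v + 1 / a\<^sup>2 * v ^ 3 - 2 / a * v\<^sup>2"
      using a by (simp add: field_simps power2_eq_square power3_eq_cube)
    finally have "ennreal (2 / a * v\<^sup>2) \<le> ennreal (v + 1 / a\<^sup>2 * v ^ 3)"
      by (intro ennreal_leI) simp
    moreover have "ennreal (2 / a * v\<^sup>2) = ennreal (2 / a) * ennreal (v\<^sup>2)"
      using a by (intro ennreal_mult) auto
    moreover have "ennreal (v + 1 / a\<^sup>2 * v ^ 3) = ennreal v + ennreal (1 / a\<^sup>2) * ennreal (v ^ 3)"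
      using a v by (subst ennreal_mult[symmetric]) auto
    ultimately show "ennreal (2 / a) * gap_pow 2 0 x \<le> gap_pow 1 0 x + ennreal (1 / a\<^sup>2) * gap_pow 3 0 x"
      by (simp add: gap_pow_def v_def)
  qed
  also have "\<dots> = EE T (gap_pow 1 0) + ennreal (1 / a\<^sup>2) * EE T (gap_pow 3 0)"
    by (simp only: mean_add mean_cmult)
  also have "\<dots> \<le> EE T (gap_pow 1 0) + ennreal (1 / a\<^sup>2) * ennreal (C * (T * sqrt T))"
    unfolding C_def by (intro add_left_mono mult_left_mono mean_gap_cube_le j T) simp
  also have "ennreal (1 / a\<^sup>2) * ennreal (C * (T * sqrt T)) = ennreal (1 / a\<^sup>2 * (C * (T * sqrt T)))"
    using C T by (intro ennreal_mult[symmetric]) auto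
  also have "1 / a\<^sup>2 * (C * (T * sqrt T)) = r / C"
    using C r unfolding r_def[symmetric] a_def by (simp add: field_simps power2_eq_square)
  also have "2 / a * T = r / C + r / C"
    using C r unfolding a_def by (simp add: field_simps power2_eq_square)
  also have "ennreal (r / C + r / C) = ennreal (r / C) + ennreal (r / C)"
    using C r by (intro ennreal_plus) auto
  finally have "ennreal (r / C) + ennreal (r / C) \<le> ennreal (r / C) + EE T (gap_pow 1 0)"
    by (simp add: add.commute)
  then show ?thesis
    by (simp add: ennreal_add_left_cancel_le r_def C_def)
qed

subsection \<open>Mean displacements\<close>

definition displacement :: "nat \<Rightarrow> (nat \<Rightarrow> int) \<Rightarrow> ennreal" where
  "displacement i x = ennreal (real_of_int (x i - x0 i))"

lemma displacement_x0: "displacement i x0 = 0"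
  by (simp add: displacement_def)

lemma displacement_push:
  assumes "admissible d x0 x" "i < d"
  shows "displacement m (push d x i) = displacement m x +
    (if i \<le> m \<and> m < d \<and> (\<forall>l. i \<le> l \<and> l < m \<longrightarrow> gap x l = 0) then 1 else 0)"
proof -
  have "0 \<le> real_of_int (x m - x0 m)"
    using admissible_ge[OF assms(1)] by simp
  moreover have "real_of_int (x m + 1 - x0 m) = real_of_int (x m - x0 m) + 1"
    by simp
  ultimately show ?thesis
    unfolding displacement_def push_apply[OF assms(2)]
    by (simp only: ennreal_plus ennreal_1 if_distrib[of "\<lambda>c. ennreal (real_of_int (x m + c - x0 m))"]) auto
qed

lemma mean_displacement_zero_le:
  assumes "0 \<le> T"
  shows "EE T (displacement 0) \<le> ennreal T"
proof -
  have "EE T (displacement 0) + (\<Sum>i<d. CC T (\<lambda>_. 0)) \<le>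
      displacement 0 x0 + (\<Sum>i<d. CC T (\<lambda>x. if i = 0 then 1 else 0))"
    by (rule dynkin_le[OF _ admissible_x0]) (auto simp: displacement_push)
  moreover have "(\<Sum>i<d. CC T (\<lambda>x. if i = 0 then 1 else 0)) = ennreal T"
    using d_ge assms by (subst sum_cumul_single) (auto simp: cumul_one)
  ultimately show ?thesis
    by (simp add: cumul_zero displacement_x0)
qed

lemma mean_displacement_ge:
  assumes "0 \<le> T" "i < d"
  shows "ennreal T \<le> EE T (displacement i)"
proof -
  have "displacement i x0 + (\<Sum>k<d. CC T (\<lambda>x. if k = i then 1 else 0)) \<le>
      EE T (displacement i) + (\<Sum>k<d. CC T (\<lambda>_. 0))"
    using assms by (intro dynkin_ge[OF _ admissible_x0]) (auto simp: displacement_push)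
  then show ?thesis
    using assms by (simp add: sum_cumul_single cumul_one cumul_zero displacement_x0)
qed

lemma mean_displacement_Suc_ge:
  assumes "0 \<le> T" "Suc j < d"
  shows "ennreal T + CC T (gap_zero j) \<le> EE T (displacement (Suc j))"
proof -
  have "displacement (Suc j) x0 +
      (\<Sum>i<d. CC T (\<lambda>x. (if i = Suc j then 1 else 0) + (if i = j then gap_zero j x else 0))) \<le>
      EE T (displacement (Suc j)) + (\<Sum>i<d. CC T (\<lambda>_. 0))"
    using assms
    by (intro dynkin_ge[OF _ admissible_x0]) (auto simp: displacement_push gap_zero_def less_Suc_eq)
  then show ?thesis
    using assms by (simp add: cumul_add sum.distrib sum_cumul_single cumul_one cumul_zero displacement_x0)
qed

text \<open>The position of particle \<open>i\<close> telescopes to that of particle 0 plus gaps.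
  The initial gaps are dropped, which leaves only nonnegative terms.\<close>

lemma displacement_le:
  assumes x: "admissible d x0 x" and i: "i < d"
  shows "displacement i x \<le> displacement 0 x + (\<Sum>l<i. gap_pow 1 l x)"
proof -
  have "x i - x0 i = (x 0 - x0 0) + (\<Sum>l<i. gap x l - gap x0 l)"
    by (induction i) (auto simp: gap_def)
  also have "\<dots> \<le> (x 0 - x0 0) + (\<Sum>l<i. gap x l)"
    using i admissible_gap[OF admissible_x0] by (intro add_left_mono sum_mono) auto
  finally have "real_of_int (x i - x0 i) \<le> real_of_int (x 0 - x0 0) + (\<Sum>l<i. real_of_int (gap x l))"
    unfolding of_int_sum[symmetric] of_int_add[symmetric] by (simp only: of_int_le_iff)
  then have "displacement i x \<le> ennreal (real_of_int (x 0 - x0 0) + (\<Sum>l<i. real_of_int (gap x l)))"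
    unfolding displacement_def by (rule ennreal_leI)
  also have "\<dots> = displacement 0 x + (\<Sum>l<i. gap_pow 1 l x)"
  proof -
    have nn: "0 \<le> real_of_int (gap x l)" if "l < i" for l
      using admissible_gap[OF x, of l] that i by simp
    have "(\<Sum>l<i. gap_pow 1 l x) = ennreal (\<Sum>l<i. real_of_int (gap x l))"
      unfolding gap_pow_def using nn by (subst sum_ennreal[symmetric]) auto
    moreover have "0 \<le> real_of_int (x 0 - x0 0)"
      using admissible_ge[OF x, of 0] by simp
    moreover have "0 \<le> (\<Sum>l<i. real_of_int (gap x l))"
      using nn by (intro sum_nonneg) auto
    ultimately show ?thesis
      by (simp only: displacement_def ennreal_plus)
  qed
  finally show ?thesis .
qed

text \<open>Adding the constants of \<open>mean_gap_le\<close> over all indices gives one constant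
  that serves every particle.\<close>

definition K :: real where
  "K = (\<Sum>l<d. (w0 l)\<^sup>2 + 3)"

lemma K_nonneg: "0 \<le> K"
  unfolding K_def by (intro sum_nonneg) simp

lemma mean_displacement_le:
  assumes T: "1 \<le> T" and i: "i < d"
  shows "EE T (displacement i) \<le> ennreal (T + K * sqrt T)"
proof -
  have T0: "0 \<le> T" using T by simp
  have "EE T (displacement i) \<le> EE T (\<lambda>x. displacement 0 x + (\<Sum>l<i. gap_pow 1 l x))"
    using i by (intro mean_mono displacement_le)
  also have "\<dots> = EE T (displacement 0) + (\<Sum>l<i. EE T (gap_pow 1 l))"
    by (simp only: mean_add mean_sum)
  also have "\<dots> \<le> ennreal T + (\<Sum>l<i. ennreal (((w0 l)\<^sup>2 + 3) * sqrt T))"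
    using i T T0 by (intro add_mono mean_displacement_zero_le sum_mono mean_gap_le) auto
  also have "(\<Sum>l<i. ennreal (((w0 l)\<^sup>2 + 3) * sqrt T)) = ennreal (\<Sum>l<i. ((w0 l)\<^sup>2 + 3) * sqrt T)"
    using T0 by (intro sum_ennreal) simp
  also have "(\<Sum>l<i. ((w0 l)\<^sup>2 + 3) * sqrt T) \<le> K * sqrt T"
    unfolding K_def sum_distrib_right using i T0 by (intro sum_mono2) auto
  then have "ennreal T + ennreal (\<Sum>l<i. ((w0 l)\<^sup>2 + 3) * sqrt T) \<le> ennreal T + ennreal (K * sqrt T)"
    by (intro add_left_mono ennreal_leI)
  also have "\<dots> = ennreal (T + K * sqrt T)"
    using T0 K_nonneg by (intro ennreal_plus[symmetric]) auto
  finally show ?thesis .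
qed

lemma expectation_displacement:
  "expectation (\<lambda>\<omega>. real_of_int (pushtasep d x0 E T \<omega> i - x0 i)) = enn2real (EE T (displacement i))"
proof -
  have "expectation (\<lambda>\<omega>. real_of_int (state_at d x0 (clocks \<omega>) T i - x0 i)) = enn2real (EE T (displacement i))"
    unfolding mean_def displacement_def
  proof (rule integral_eq_nn_integral)
    show "(\<lambda>\<omega>. real_of_int (state_at d x0 (clocks \<omega>) T i - x0 i)) \<in> borel_measurable M"
      by (rule measurable_fun_state_at_clocks)
    show "AE \<omega> in M. 0 \<le> real_of_int (state_at d x0 (clocks \<omega>) T i - x0 i)"
      using admissible_ge[OF admissible_state_at[OF admissible_x0]] by simp
  qed
  then show ?thesis
    by (simp add: pushtasep_eq_state_at clocks_def)
qed

lemma expectation_displacement_bounds: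
  assumes T: "1 \<le> T" and i: "i < d"
  shows "\<bar>expectation (\<lambda>\<omega>. real_of_int (pushtasep d x0 E T \<omega> i - x0 i)) - T\<bar> \<le> K * sqrt T"
proof -
  have "enn2real (EE T (displacement i)) \<le> T + K * sqrt T"
    using mean_displacement_le[OF assms] T K_nonneg by (intro enn2real_leI) auto
  moreover have "EE T (displacement i) < \<infinity>"
    using le_less_trans[OF mean_displacement_le[OF assms]] by simp
  then have "T \<le> enn2real (EE T (displacement i))"
    using mean_displacement_ge[of T i] assms by (cases "EE T (displacement i)") auto
  ultimately show ?thesis
    unfolding expectation_displacement by simp
qed

subsection \<open>Occupation time of the boundary\<close>

definition boundary :: "(nat \<Rightarrow> int) \<Rightarrow> ennreal" where
  "boundary x = (if in_B d x then 1 else 0)"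

lemma cumul_boundary_le:
  assumes T: "1 \<le> T"
  shows "CC T boundary \<le> ennreal (real d * K * sqrt T)"
proof -
  have T0: "0 \<le> T" using T by simp
  have zero: "CC T (gap_zero j) \<le> ennreal (K * sqrt T)" if j: "Suc j < d" for j
  proof -
    have "ennreal T + CC T (gap_zero j) \<le> ennreal (T + K * sqrt T)"
      using mean_displacement_Suc_ge[OF T0 j] mean_displacement_le[OF T j] by (rule order_trans)
    also have "\<dots> = ennreal T + ennreal (K * sqrt T)"
      using T0 K_nonneg by (intro ennreal_plus) auto
    finally show ?thesis by (simp add: ennreal_add_left_cancel_le)
  qed
  have "CC T boundary \<le> CC T (\<lambda>x. \<Sum>j<d - 1. gap_zero j x)"
  proof (intro cumul_mono)
    fix x
    show "boundary x \<le> (\<Sum>j<d - 1. gap_zero j x)"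
    proof (cases "in_B d x")
      case True
      then obtain i where i: "i < d - 1" "gap x i = 0" by (auto simp: in_B_def)
      then have "boundary x \<le> gap_zero i x" by (simp add: boundary_def gap_zero_def)
      also have "\<dots> \<le> (\<Sum>j<d - 1. gap_zero j x)"
        using i by (intro member_le_sum) auto
      finally show ?thesis .
    qed (simp add: boundary_def)
  qed
  also have "\<dots> = (\<Sum>j<d - 1. CC T (gap_zero j))"
    by (rule cumul_sum)
  also have "\<dots> \<le> (\<Sum>j<d - 1. ennreal (K * sqrt T))"
    by (intro sum_mono zero) auto
  also have "\<dots> = ennreal (\<Sum>j<d - 1. K * sqrt T)"
    using K_nonneg T0 by (intro sum_ennreal) simp
  also have "\<dots> \<le> ennreal (real d * K * sqrt T)"
    using K_nonneg T0 by (intro ennreal_leI) (simp add: mult_right_mono mult.assoc)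
  finally show ?thesis .
qed

lemma cumul_boundary_ge:
  assumes T: "1 \<le> T"
  shows "ennreal (sqrt T / (w0 0 ^ 3 + 6 * (w0 0)\<^sup>2 + 19)) \<le> ennreal (w0 0) + CC T boundary"
proof -
  have j: "Suc 0 < d" using d_ge by simp
  have "ennreal (sqrt T / (w0 0 ^ 3 + 6 * (w0 0)\<^sup>2 + 19)) \<le> EE T (gap_pow 1 0)"
    by (rule mean_first_gap_ge[OF T])
  also have "\<dots> \<le> gap_pow 1 0 x0 + CC T (gap_zero 0)"
    using T by (intro cumul_gap_zero_ge j) simp
  also have "CC T (gap_zero 0) \<le> CC T boundary"
  proof (intro cumul_mono)
    fix x assume "admissible d x0 x"
    \<comment> \<open>\<open>in_B\<close> also demands that all gaps be nonnegative, which
      admissibility supplies.\<close>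
    then show "gap_zero 0 x \<le> boundary x"
      using j by (auto simp: gap_zero_def boundary_def in_B_def admissible_gap)
  qed
  finally show ?thesis by (simp add: gap_pow_x0)
qed

lemma expectation_occupation:
  assumes T: "0 \<le> T"
  shows "expectation (occupation d x0 E T) = enn2real (CC T boundary)"
proof -
  define N where "N \<omega> = (\<integral>\<^sup>+s. indicator {0..T} s * boundary (state_at d x0 (clocks \<omega>) s) \<partial>lborel)" for \<omega>
  have occ: "occupation d x0 E T \<omega> = enn2real (N \<omega>)" for \<omega>
  proof -
    let ?f = "\<lambda>s. if in_B d (state_at d x0 (clocks \<omega>) s) then 1 else 0 :: real"
    have [measurable]: "?f \<in> borel_measurable borel"
      by (rule measurable_fun_state_at) simp_all
    have "occupation d x0 E T \<omega> = (LBINT s:{0..T}. ?f s)"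
      unfolding occupation_def pushtasep_eq_state_at clocks_def[symmetric] zero_ereal_def
      using T by (rule interval_integral_Icc)
    also have "\<dots> = enn2real (\<integral>\<^sup>+s. ennreal (indicator {0..T} s *\<^sub>R ?f s) \<partial>lborel)"
      unfolding set_lebesgue_integral_def by (rule integral_eq_nn_integral) auto
    also have "(\<integral>\<^sup>+s. ennreal (indicator {0..T} s *\<^sub>R ?f s) \<partial>lborel) = N \<omega>"
      unfolding N_def by (intro nn_integral_cong) (auto simp: boundary_def split: split_indicator)
    finally show ?thesis .
  qed
  \<comment> \<open>Since the occupation time never exceeds \<open>T\<close>, passing through
    \<open>enn2real\<close> loses nothing.\<close>
  have N_le: "N \<omega> \<le> ennreal T" for \<omega>
  proof -
    have "N \<omega> \<le> (\<integral>\<^sup>+s. indicator {0..T} s \<partial>lborel)"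
      unfolding N_def by (intro nn_integral_mono) (auto simp: boundary_def split: split_indicator)
    then show ?thesis using T by simp
  qed
  note [measurable] = measurable_state_at_pair[of boundary x0]
  have "(\<lambda>p. indicator {0..T} (snd p) * boundary (state_at d x0 (clocks (fst p)) (snd p))) \<in> borel_measurable (M \<Otimes>\<^sub>M lborel)"
    by measurable
  from lborel.borel_measurable_nn_integral_fst[OF this] have [measurable]: "N \<in> borel_measurable M"
    unfolding fst_conv snd_conv N_def .
  have "expectation (occupation d x0 E T) = expectation (\<lambda>\<omega>. enn2real (N \<omega>))"
    by (simp add: occ cong: Bochner_Integration.integral_cong)
  also have "\<dots> = enn2real (\<integral>\<^sup>+\<omega>. ennreal (enn2real (N \<omega>)) \<partial>M)"
    by (rule integral_eq_nn_integral) auto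
  also have "(\<integral>\<^sup>+\<omega>. ennreal (enn2real (N \<omega>)) \<partial>M) = (\<integral>\<^sup>+\<omega>. N \<omega> \<partial>M)"
    by (intro nn_integral_cong ennreal_enn2real le_less_trans[OF N_le ennreal_less_top])
  also have "\<dots> = CC T boundary"
    unfolding N_def cumul_eq ..
  finally show ?thesis .
qed

lemma expectation_occupation_bounds:
  assumes T: "1 \<le> T"
  shows "expectation (occupation d x0 E T) \<le> real d * K * sqrt T"
    and "sqrt T / (w0 0 ^ 3 + 6 * (w0 0)\<^sup>2 + 19) - w0 0 \<le> expectation (occupation d x0 E T)"
proof -
  have T0: "0 \<le> T" using T by simp
  have w: "0 \<le> w0 0" using d_ge by (intro w0_nonneg) simp
  have fin: "CC T boundary < \<infinity>"
    using le_less_trans[OF cumul_boundary_le[OF T]] by simp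
  show "expectation (occupation d x0 E T) \<le> real d * K * sqrt T"
    unfolding expectation_occupation[OF T0] using cumul_boundary_le[OF T] T0 K_nonneg
    by (intro enn2real_leI) auto
  have "ennreal (sqrt T / (w0 0 ^ 3 + 6 * (w0 0)\<^sup>2 + 19)) \<le> ennreal (w0 0) + ennreal (enn2real (CC T boundary))"
    using cumul_boundary_ge[OF T] fin by simp
  also have "\<dots> = ennreal (w0 0 + enn2real (CC T boundary))"
    using w by (intro ennreal_plus[symmetric]) auto
  finally show "sqrt T / (w0 0 ^ 3 + 6 * (w0 0)\<^sup>2 + 19) - w0 0 \<le> expectation (occupation d x0 E T)"
    unfolding expectation_occupation[OF T0] using w by (subst (asm) ennreal_le_iff) auto
qed

end

section \<open>Asymptotic form of the bounds\<close>

theorem theorem2p4: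
  fixes M :: "'a measure" and d :: nat and x0 :: "nat \<Rightarrow> int"
    and E :: "nat \<Rightarrow> nat \<Rightarrow> 'a \<Rightarrow> real"
  assumes "prob_space M"
    and "d \<ge> 2"
    and "\<And>i. Suc i < d \<Longrightarrow> x0 i < x0 (Suc i)"
    and "prob_space.indep_vars M (\<lambda>_. borel) (\<lambda>(i, k). E i k) ({..<d} \<times> UNIV)"
    and "\<And>i k. i < d \<Longrightarrow> distributed M lborel (E i k) (exponential_density 1)"
  shows "(\<lambda>T. prob_space.expectation M (occupation d x0 E T)) \<in> \<Theta>[at_top](\<lambda>T. sqrt T) \<and>
    (\<forall>i < d.
      (\<lambda>T. prob_space.expectation M (\<lambda>\<omega>. real_of_int (pushtasep d x0 E T \<omega> i - x0 i)) - T)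
        \<in> O[at_top](\<lambda>T. sqrt T))"
proof -
  interpret prob_space M by fact
  interpret pushtasep_process M d E x0
    by unfold_locales (use assms in auto)
  define C where "C = w0 0 ^ 3 + 6 * (w0 0)\<^sup>2 + 19"
  have w: "0 \<le> w0 0" using d_ge by (intro w0_nonneg) simp
  then have C: "0 < C" by (simp add: C_def add_nonneg_pos)
  have "(\<lambda>T. expectation (occupation d x0 E T)) \<in> O[at_top](\<lambda>T. sqrt T)"
  proof (rule bigoI)
    show "\<forall>\<^sub>F T in at_top. norm (expectation (occupation d x0 E T)) \<le> real d * K * norm (sqrt T)"
      using eventually_ge_at_top[of 1]
    proof eventually_elim
      case (elim T)
      then have "0 \<le> expectation (occupation d x0 E T)"
        by (simp add: expectation_occupation)
      then show ?case
        using expectation_occupation_bounds(1)[OF elim] elim by simp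
    qed
  qed
  moreover have "(\<lambda>T. expectation (occupation d x0 E T)) \<in> \<Omega>[at_top](\<lambda>T. sqrt T)"
  proof (rule landau_omega.bigI)
    show "0 < 1 / (2 * C)" using C by simp
    show "\<forall>\<^sub>F T in at_top. 1 / (2 * C) * norm (sqrt T) \<le> norm (expectation (occupation d x0 E T))"
      \<comment> \<open>From this threshold on \<open>w0 0\<close> is at most half of
        \<open>sqrt T / C\<close>, so half of the main term survives its subtraction; hence the
        constant \<open>1 / (2 * C)\<close>.\<close>
      using eventually_ge_at_top[of "max 1 ((2 * C * w0 0)\<^sup>2)"]
    proof eventually_elim
      case (elim T)
      then have T: "1 \<le> T" by simp
      have "2 * C * w0 0 = sqrt ((2 * C * w0 0)\<^sup>2)"
        using w C by simp
      also have "\<dots> \<le> sqrt T"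
        using elim by (intro real_sqrt_le_mono) simp
      finally have "w0 0 \<le> sqrt T / (2 * C)"
        using C by (simp add: field_simps)
      then have "1 / (2 * C) * sqrt T \<le> sqrt T / C - w0 0"
        by (simp add: field_simps)
      also have "\<dots> \<le> expectation (occupation d x0 E T)"
        unfolding C_def by (rule expectation_occupation_bounds(2)[OF T])
      finally show ?case
        using T by simp
    qed
  qed
  moreover have "(\<lambda>T. expectation (\<lambda>\<omega>. real_of_int (pushtasep d x0 E T \<omega> i - x0 i)) - T) \<in> O[at_top](\<lambda>T. sqrt T)"
    if "i < d" for i
  proof (rule bigoI)
    show "\<forall>\<^sub>F T in at_top. norm (expectation (\<lambda>\<omega>. real_of_int (pushtasep d x0 E T \<omega> i - x0 i)) - T) \<le> K * norm (sqrt T)"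
      using eventually_ge_at_top[of 1]
      by eventually_elim (use expectation_displacement_bounds[OF _ that] in simp)
  qed
  ultimately show ?thesis
    by (auto simp: bigtheta_def)
qed

end
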